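(* Let $\theta=1$. There exists a constant $C>0$, not depending on $N$ nor $k$, such that for all integers $N\ge1$ and $1\le k\le N/3$, with $\rho=k/N$, the spectral gap on $\Sigma_{N,k}$ satisfies $$\lambda_N(\mathcal{L}^N_{\theta,\Lambda_N})\ \ge\ C\,\frac{\rho^2}{N^2}.$$
   Context: $\Lambda_N=\{1,\dots,N\}$ and $\chi^N=\{0,1\}^{\Lambda_N}$. $\Sigma_{N,k}=\{\eta\in\chi^N:\sum_{x\in\Lambda_N}\eta(x)=k\}$ and $\nu_{N,k}$ is the uniform probability measure on $\Sigma_{N,k}$. $\eta^{x,y}$ is $\eta$ with the values at $x$ and $y$ exchanged. The rates are $c(x,x+1,\eta)=c(x+1,x,\eta)=\eta(x-1)+\eta(x+2)$ with the convention $\eta(0)=\eta(N+1)=0$ (frozen empty boundary). The generator is $$(\mathcal{L}^N_{\theta,\Lambda_N}f)(\eta)=\sum_{x,y\in\Lambda_N,\ |x-y|=1}\big(c(x,y,\eta)+N^{\theta-2}\big)\,\eta(x)(1-\eta(y))(f(\eta^{x,y})-f(\eta))$$ (sum over ordered pairs). It is reversible with respect to $\nu_{N,k}$, and its spectral gap is $$\lambda_N(\mathcal{L})=\inf_f\frac{\mathfrak{D}_{\mathcal{L}}(f,\nu_{N,k})}{\mathrm{Var}(f,\nu_{N,k})},\qquad \mathfrak{D}_{\mathcal{L}}(f,\mu)=\int -f\,\mathcal{L}f\,d\mu,$$ the infimum being over functions $f:\Sigma_{N,k}\to\mathbb{R}$ with nonzero variance. *)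

theory Defs
  imports "HOL-Probability.Probability"
begin

definition sites :: "nat \<Rightarrow> nat set" where
  "sites N = {1..N}"

text \<open>
  A configuration on the sites is represented by its extension by zero to all of \<^typ>\<open>nat\<close>,
  which is the frozen empty boundary convention \<open>\<eta>(0) = \<eta>(N+1) = 0\<close>.
\<close>

definition configs :: "nat \<Rightarrow> (nat \<Rightarrow> nat) set" where
  "configs N = {\<eta>. (\<forall>x\<in>sites N. \<eta> x \<in> {0, 1}) \<and> (\<forall>x. x \<notin> sites N \<longrightarrow> \<eta> x = 0)}"

definition hyperplane :: "nat \<Rightarrow> nat \<Rightarrow> (nat \<Rightarrow> nat) set" where
  "hyperplane N k = {\<eta> \<in> configs N. (\<Sum>x\<in>sites N. \<eta> x) = k}"

definition canonical :: "nat \<Rightarrow> nat \<Rightarrow> (nat \<Rightarrow> nat) pmf" where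
  "canonical N k = pmf_of_set (hyperplane N k)"

definition exchange :: "nat \<Rightarrow> nat \<Rightarrow> (nat \<Rightarrow> nat) \<Rightarrow> (nat \<Rightarrow> nat)" where
  "exchange x y \<eta> = \<eta> \<circ> Transposition.transpose x y"

text \<open>
  Used only for neighbouring sites: if \<open>{x, y} = {z, z + 1}\<close> with \<open>z \<ge> 1\<close>, the rate is
  \<open>\<eta>(z - 1) + \<eta>(z + 2)\<close>, and the subtraction does not truncate.
\<close>

definition pmm_rate :: "nat \<Rightarrow> nat \<Rightarrow> (nat \<Rightarrow> nat) \<Rightarrow> nat" where
  "pmm_rate x y \<eta> = \<eta> (min x y - 1) + \<eta> (max x y + 1)"

definition generator ::
    "real \<Rightarrow> nat \<Rightarrow> ((nat \<Rightarrow> nat) \<Rightarrow> real) \<Rightarrow> ((nat \<Rightarrow> nat) \<Rightarrow> real)" where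
  "generator \<theta> N f \<eta> =
     (\<Sum>(x, y) \<in> {(x, y). x \<in> sites N \<and> y \<in> sites N \<and> \<bar>int x - int y\<bar> = 1}.
        (real (pmm_rate x y \<eta>) + real N powr (\<theta> - 2)) *
        real (\<eta> x) * (1 - real (\<eta> y)) * (f (exchange x y \<eta>) - f \<eta>))"

definition dirichlet_form ::
    "(('a \<Rightarrow> real) \<Rightarrow> ('a \<Rightarrow> real)) \<Rightarrow> 'a pmf \<Rightarrow> ('a \<Rightarrow> real) \<Rightarrow> real" where
  "dirichlet_form L \<mu> f = measure_pmf.expectation \<mu> (\<lambda>\<eta>. - f \<eta> * L f \<eta>)"

text \<open>
  Test functions are total, but for an operator such as \<^term>\<open>generator \<theta> N\<close>, which preserves
  the hyperplane, the quotient depends only on their values on the support of the measure.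
  The infimum is taken in \<^typ>\<open>real\<close>; for \<open>0 < k < N\<close> it ranges over a nonempty set that is
  bounded below by 0.
\<close>

definition spectral_gap :: "(('a \<Rightarrow> real) \<Rightarrow> ('a \<Rightarrow> real)) \<Rightarrow> 'a pmf \<Rightarrow> real" where
  "spectral_gap L \<mu> =
     (INF f \<in> {f. measure_pmf.variance \<mu> f \<noteq> 0}.
        dirichlet_form L \<mu> f / measure_pmf.variance \<mu> f)"

end

theory Submission
  imports Defs
begin

text \<open>
  Exclusion with all exchanges allowed at equal rate has a gap of order \<open>N\<close>; this is proved by
  induction on the number of sites. It serves as reference process twice.

  For \<open>k = 1\<close> the rates \<open>1 / N\<close> alone suffice. For \<open>k \<ge> 2\<close> consider first the configurations with
  particles at \<open>u\<close> and \<open>u + 1\<close>. Such a pair travels anywhere using jumps of rate at least 1,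
  carries along the content of a site, and so realises every exchange among the other
  sites in \<open>O(N)\<close> jumps. Hence \<open>f\<close> is close in mean square to one constant \<open>c\<close>, the same for all \<open>u\<close>, on
  the configurations with a pair at \<open>u\<close>. Next, every configuration has at least \<open>k / 4\<close> pairs of particles at
  distance at most \<open>L = O(N / k)\<close>; bringing two such particles together takes at most \<open>L\<close> jumps of rate
  \<open>1 / N\<close>. Averaging \<open>(f - c)\<^sup>2\<close> over these pairs bounds the variance. All path arguments are
  triangle inequalities in \<open>L\<^sup>2\<close>, since each single exchange is a bijection.
\<close>

section \<open>Configurations and exchanges\<close>

text \<open>Arbitrary site sets are allowed because the induction below removes single sites and
  because the surroundings of a travelling pair live on \<open>{3..N}\<close>. Extension by zero
  makes a configuration with \<open>x\<close> vacant literally a configuration on the smaller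
  set.\<close>

definition configs_on :: "nat set \<Rightarrow> nat \<Rightarrow> (nat \<Rightarrow> nat) set" where
  "configs_on A k =
     {\<eta>. (\<forall>x\<in>A. \<eta> x \<in> {0, 1}) \<and> (\<forall>x. x \<notin> A \<longrightarrow> \<eta> x = 0) \<and> (\<Sum>x\<in>A. \<eta> x) = k}"

lemma hyperplane_eq: "hyperplane N k = configs_on {1..N} k"
  by (auto simp: hyperplane_def configs_def sites_def configs_on_def)

lemma configs_on_01: "\<eta> \<in> configs_on A k \<Longrightarrow> \<eta> x = 0 \<or> \<eta> x = 1"
  by (cases "x \<in> A") (auto simp: configs_on_def)

lemma bij_betw_occupy:
  assumes "finite A" "x \<notin> A"
  shows "bij_betw (\<lambda>\<eta>. \<eta>(x := 1)) (configs_on A k) {\<eta> \<in> configs_on (insert x A) (Suc k). \<eta> x = 1}"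
proof (rule bij_betw_byWitness[where f' = "\<lambda>\<eta>. \<eta>(x := 0)"])
  have s: "(\<Sum>y\<in>A. (\<eta>(x := c)) y) = (\<Sum>y\<in>A. \<eta> y)" for \<eta> :: "nat \<Rightarrow> nat" and c
    using assms by (intro sum.cong) auto
  show "\<forall>\<eta>\<in>configs_on A k. (\<eta>(x := 1))(x := 0) = \<eta>"
    using assms by (auto simp: configs_on_def fun_eq_iff)
  show "\<forall>\<eta>\<in>{\<eta> \<in> configs_on (insert x A) (Suc k). \<eta> x = 1}. (\<eta>(x := 0))(x := 1) = \<eta>"
    by (auto simp: fun_eq_iff)
  show "(\<lambda>\<eta>. \<eta>(x := 1)) ` configs_on A k \<subseteq> {\<eta> \<in> configs_on (insert x A) (Suc k). \<eta> x = 1}"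
  proof safe
    fix \<eta> assume h: "\<eta> \<in> configs_on A k"
    have "\<forall>y\<in>insert x A. (\<eta>(x := 1)) y \<in> {0, 1}"
      using configs_on_01[OF h] by auto
    then show "\<eta>(x := 1) \<in> configs_on (insert x A) (Suc k)"
      using h assms s[of \<eta> 1] by (auto simp: configs_on_def)
  qed simp
  show "(\<lambda>\<eta>. \<eta>(x := 0)) ` {\<eta> \<in> configs_on (insert x A) (Suc k). \<eta> x = 1} \<subseteq> configs_on A k"
  proof safe
    fix \<eta> :: "nat \<Rightarrow> nat" assume h: "\<eta> \<in> configs_on (insert x A) (Suc k)" "\<eta> x = 1"
    have "\<forall>y\<in>A. (\<eta>(x := 0)) y \<in> {0, 1}"
      using configs_on_01[OF h(1)] by auto
    then show "\<eta>(x := 0) \<in> configs_on A k"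
      using h assms s[of \<eta> 0] by (auto simp: configs_on_def)
  qed
qed

lemma vacant_eq:
  assumes "finite A" "x \<notin> A"
  shows "{\<eta> \<in> configs_on (insert x A) k. \<eta> x = 0} = configs_on A k"
proof (intro set_eqI)
  fix \<eta> :: "nat \<Rightarrow> nat"
  have "(\<forall>y. y \<notin> A \<longrightarrow> \<eta> y = 0) \<longleftrightarrow> (\<forall>y. y \<notin> insert x A \<longrightarrow> \<eta> y = 0) \<and> \<eta> x = 0"
    using assms(2) by (metis insert_iff)
  then show "\<eta> \<in> {\<eta> \<in> configs_on (insert x A) k. \<eta> x = 0} \<longleftrightarrow> \<eta> \<in> configs_on A k"
    unfolding configs_on_def using assms by auto
qed

lemma configs_on_split:
  "configs_on A k = {\<eta> \<in> configs_on A k. \<eta> x = 1} \<union> {\<eta> \<in> configs_on A k. \<eta> x = 0}"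
  using configs_on_01 by blast

lemma configs_on_0: "finite A \<Longrightarrow> configs_on A 0 = {\<lambda>_. 0}"
  by (auto simp: configs_on_def fun_eq_iff)

lemma card_configs_on:
  assumes "finite A"
  shows "finite (configs_on A k) \<and> card (configs_on A k) = card A choose k"
  using assms
proof (induction A arbitrary: k rule: finite_induct)
  case empty
  show ?case
  proof (cases k)
    case 0
    then show ?thesis by (simp add: configs_on_0)
  next
    case (Suc j)
    then have "configs_on {} k = {}" by (auto simp: configs_on_def)
    then show ?thesis using Suc by simp
  qed
next
  case (insert x A)
  show ?case
  proof (cases k)
    case 0
    then show ?thesis using insert by (simp add: configs_on_0)
  next
    case (Suc j)
    have b: "bij_betw (\<lambda>\<eta>. \<eta>(x := 1)) (configs_on A j) {\<eta> \<in> configs_on (insert x A) k. \<eta> x = 1}"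
      using bij_betw_occupy insert Suc by simp
    have "finite {\<eta> \<in> configs_on (insert x A) k. \<eta> x = 1}"
      "card {\<eta> \<in> configs_on (insert x A) k. \<eta> x = 1} = card A choose j"
      using insert.IH[of j] bij_betw_finite[OF b] bij_betw_same_card[OF b] by auto
    moreover have "finite {\<eta> \<in> configs_on (insert x A) k. \<eta> x = 0}"
      "card {\<eta> \<in> configs_on (insert x A) k. \<eta> x = 0} = card A choose k"
      using insert.IH[of k] vacant_eq insert by auto
    moreover have "{\<eta> \<in> configs_on (insert x A) k. \<eta> x = 1} \<inter>
        {\<eta> \<in> configs_on (insert x A) k. \<eta> x = 0} = {}" by auto
    ultimately have
      "finite ({\<eta> \<in> configs_on (insert x A) k. \<eta> x = 1} \<union> {\<eta> \<in> configs_on (insert x A) k. \<eta> x = 0})"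
      "card ({\<eta> \<in> configs_on (insert x A) k. \<eta> x = 1} \<union> {\<eta> \<in> configs_on (insert x A) k. \<eta> x = 0})
        = (card A choose j) + (card A choose k)"
      by (simp_all only: card_Un_disjoint finite_UnI)
    then show ?thesis
      unfolding configs_on_split[of "insert x A" k x, symmetric] using insert.hyps Suc by simp
  qed
qed

lemmas finite_configs_on = card_configs_on[THEN conjunct1]

lemma sum_occupied:
  assumes "finite A" "x \<notin> A"
  shows "(\<Sum>\<eta> | \<eta> \<in> configs_on (insert x A) (Suc k) \<and> \<eta> x = 1. g \<eta>)
       = (\<Sum>\<eta>\<in>configs_on A k. g (\<eta>(x := 1)))"
  using sum.reindex_bij_betw[OF bij_betw_occupy[OF assms], of g k] by simp

lemma sum_configs_on_split:
  assumes "finite A" "x \<notin> A"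
  shows "(\<Sum>\<eta>\<in>configs_on (insert x A) (Suc k). g \<eta>)
       = (\<Sum>\<eta>\<in>configs_on A k. g (\<eta>(x := 1))) + (\<Sum>\<eta>\<in>configs_on A (Suc k). g \<eta>)"
proof -
  have "finite (configs_on (insert x A) (Suc k))"
    using assms finite_configs_on by blast
  then have "(\<Sum>\<eta>\<in>configs_on (insert x A) (Suc k). g \<eta>)
     = (\<Sum>\<eta> | \<eta> \<in> configs_on (insert x A) (Suc k) \<and> \<eta> x = 1. g \<eta>)
      + (\<Sum>\<eta> | \<eta> \<in> configs_on (insert x A) (Suc k) \<and> \<eta> x = 0. g \<eta>)"
    by (subst configs_on_split[of _ _ x], subst sum.union_disjoint) auto
  then show ?thesis by (simp only: sum_occupied[OF assms] vacant_eq[OF assms])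
qed

section \<open>Exchanges of two sites\<close>

lemma exchange_in:
  assumes "finite A" "x \<in> A" "y \<in> A" "\<eta> \<in> configs_on A k"
  shows "exchange x y \<eta> \<in> configs_on A k"
proof -
  have p: "Transposition.transpose x y permutes A"
    using assms by (simp add: permutes_swap_id)
  have "(\<Sum>z\<in>A. exchange x y \<eta> z) = (\<Sum>z\<in>A. \<eta> z)"
    using sum.permute[OF p, of \<eta>] by (simp add: exchange_def)
  moreover have "\<forall>z\<in>A. exchange x y \<eta> z \<in> {0, 1}"
    using configs_on_01[OF assms(4)] by (auto simp: exchange_def)
  moreover have "\<forall>z. z \<notin> A \<longrightarrow> exchange x y \<eta> z = 0"
  proof safe
    fix z assume "z \<notin> A"
    then show "exchange x y \<eta> z = 0"
      using assms by (cases "z = x"; cases "z = y") (auto simp: exchange_def configs_on_def)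
  qed
  ultimately show ?thesis using assms(4) by (simp add: configs_on_def)
qed

lemma exchange_exchange [simp]: "exchange x y (exchange x y \<eta>) = \<eta>"
  by (auto simp: exchange_def fun_eq_iff)

lemma exchange_same [simp]: "exchange x x \<eta> = \<eta>"
  by (simp add: exchange_def)

lemma exchange_commute: "exchange x y = exchange y x"
  by (simp add: exchange_def transpose_commute fun_eq_iff)

lemma exchange_apply: "exchange x y \<eta> z = (if z = x then \<eta> y else if z = y then \<eta> x else \<eta> z)"
  by (simp add: exchange_def transpose_def)

lemma exchange_upd: "x \<noteq> y \<Longrightarrow> x \<noteq> z \<Longrightarrow> exchange y z (\<eta>(x := c)) = (exchange y z \<eta>)(x := c)"
  by (auto simp: exchange_apply fun_eq_iff)

lemma bij_betw_exchange:
  assumes "exchange x y ` X \<subseteq> Y" "exchange x y ` Y \<subseteq> X"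
  shows "bij_betw (exchange x y) X Y"
  using assms by (intro bij_betw_byWitness[where f' = "exchange x y"]) auto

section \<open>Sums of squared deviations from the mean\<close>

definition sq_dev :: "('a \<Rightarrow> real) \<Rightarrow> 'a set \<Rightarrow> real" where
  "sq_dev f X = (\<Sum>\<eta>\<in>X. (f \<eta> - (\<Sum>\<xi>\<in>X. f \<xi>) / card X)\<^sup>2)"

text \<open>\<open>sq_dev\<close> is the variance of the uniform measure times
  \<open>card X\<close>, so contributions of disjoint classes can be added directly. Expanding
  around \<open>c\<close> instead of the mean leaves only the squared total deviation as a
  correction.\<close>

lemma sq_dev_shift:
  assumes "finite X"
  shows "sq_dev f X = (\<Sum>\<eta>\<in>X. (f \<eta> - c)\<^sup>2) - (\<Sum>\<eta>\<in>X. f \<eta> - c)\<^sup>2 / card X"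
proof (cases "X = {}")
  case False
  define n where "n = real (card X)"
  have n: "n > 0" using assms False by (simp add: n_def card_gt_0_iff)
  define t where "t = (\<Sum>\<eta>\<in>X. f \<eta> - c) / n"
  have t: "(\<Sum>\<eta>\<in>X. f \<eta> - c) = n * t" using n by (simp add: t_def)
  have m: "(\<Sum>\<xi>\<in>X. f \<xi>) / n = t + c"
    using n by (simp add: t_def sum_subtractf n_def field_simps)
  have "sq_dev f X = (\<Sum>\<eta>\<in>X. ((f \<eta> - c) - t)\<^sup>2)"
    unfolding sq_dev_def n_def[symmetric] m by (simp add: algebra_simps)
  also have "\<dots> = (\<Sum>\<eta>\<in>X. (f \<eta> - c)\<^sup>2) - 2 * t * (\<Sum>\<eta>\<in>X. f \<eta> - c) + n * t\<^sup>2"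
    by (simp add: power2_diff[of _ t] sum.distrib sum_subtractf sum_distrib_left n_def
        right_diff_distrib sum_distrib_right mult_ac)
  also have "\<dots> = (\<Sum>\<eta>\<in>X. (f \<eta> - c)\<^sup>2) - (n * t)\<^sup>2 / n"
    using n by (simp add: t power2_eq_square)
  finally show ?thesis using t by (simp add: n_def)
qed (simp add: sq_dev_def)

lemma sq_dev_le: "finite X \<Longrightarrow> sq_dev f X \<le> (\<Sum>\<eta>\<in>X. (f \<eta> - c)\<^sup>2)"
  by (simp add: sq_dev_shift[of X f c])

section \<open>The gap of the exclusion process on the complete graph\<close>

lemma sq_dev_card_le_1:
  assumes "finite X" "card X \<le> 1"
  shows "sq_dev f X = 0"
proof (cases "X = {}")
  case False
  then have "card X = 1" using assms by (simp add: card_gt_0_iff le_antisym Suc_le_eq)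
  then obtain a where "X = {a}" by (auto simp: card_1_singleton_iff)
  then show ?thesis by (simp add: sq_dev_def)
qed (simp add: sq_dev_def)

lemma configs_on_doubleton:
  assumes "a \<noteq> b"
  shows "configs_on {a, b} 1 = {(\<lambda>_. 0)(a := 1), (\<lambda>_. 0)(b := 1)}"
proof -
  have "\<eta> = (\<lambda>_. 0)(a := 1) \<or> \<eta> = (\<lambda>_. 0)(b := 1)" if h: "\<eta> \<in> configs_on {a, b} 1" for \<eta>
  proof -
    have "\<eta> a + \<eta> b = 1" "\<forall>x. x \<noteq> a \<longrightarrow> x \<noteq> b \<longrightarrow> \<eta> x = 0"
      using h assms by (auto simp: configs_on_def)
    then have "\<eta> a = 0 \<and> \<eta> b = 1 \<or> \<eta> a = 1 \<and> \<eta> b = 0" by linarith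
    then show ?thesis
    proof
      assume "\<eta> a = 0 \<and> \<eta> b = 1"
      then have "\<eta> x = ((\<lambda>_. 0)(b := 1)) x" for x
        using \<open>\<forall>x. x \<noteq> a \<longrightarrow> x \<noteq> b \<longrightarrow> \<eta> x = 0\<close> by (cases "x = a") auto
      then show ?thesis by blast
    next
      assume "\<eta> a = 1 \<and> \<eta> b = 0"
      then have "\<eta> x = ((\<lambda>_. 0)(a := 1)) x" for x
        using \<open>\<forall>x. x \<noteq> a \<longrightarrow> x \<noteq> b \<longrightarrow> \<eta> x = 0\<close> by (cases "x = b") auto
      then show ?thesis by blast
    qed
  qed
  moreover have "(\<lambda>_. 0)(a := 1) \<in> configs_on {a, b} 1" "(\<lambda>_. 0)(b := 1) \<in> configs_on {a, b} 1"
    using assms by (auto simp: configs_on_def)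
  ultimately show ?thesis by blast
qed

text \<open>Start of the induction on sites, where both sides agree: there are two configurations,
  and both ordered pairs swap them. The induction step cannot reach this case, since it cancels a
  factor that vanishes for two sites.\<close>

lemma exchange_gap_doubleton:
  assumes "a \<noteq> b"
  shows "8 * sq_dev f (configs_on {a, b} 1) \<le>
    (\<Sum>x\<in>{a, b}. \<Sum>y\<in>{a, b}. \<Sum>\<eta>\<in>configs_on {a, b} 1. (f (exchange x y \<eta>) - f \<eta>)\<^sup>2)"
proof -
  define u v :: "nat \<Rightarrow> nat" where "u = (\<lambda>_. 0)(a := 1)" and "v = (\<lambda>_. 0)(b := 1)"
  have X: "configs_on {a, b} 1 = {u, v}"
    using configs_on_doubleton[OF assms] by (simp add: u_def v_def)
  have ne: "u \<noteq> v" using assms by (auto simp: u_def v_def fun_eq_iff)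
  have e: "exchange a b u = v" "exchange b a u = v" "exchange a b v = u" "exchange b a v = u"
    using assms by (auto simp: u_def v_def fun_eq_iff exchange_apply)
  have "sq_dev f {u, v} = (f u - (f u + f v) / 2)\<^sup>2 + (f v - (f u + f v) / 2)\<^sup>2"
    using ne by (simp add: sq_dev_def)
  also have "\<dots> = (f u - f v)\<^sup>2 / 2" by (simp add: power2_eq_square field_simps)
  finally show ?thesis
    unfolding X using ne assms e by (simp add: power2_commute[of "f v" "f u"])
qed

text \<open>By absorption the two ratios are \<open>(m + 1 - j) / (m + 1)\<close> and
  \<open>(j + 1) / (m + 1)\<close>. Their sum is the total loss in the induction step.\<close>

lemma binomial_ratio_sum:
  assumes "j \<le> m"
  shows "real (m choose j) * (1 / real (Suc m choose j) + 1 / real (Suc m choose Suc j))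
     = real (m + 2) / real (m + 1)"
proof -
  have p: "real (Suc m choose j) > 0" "real (Suc m choose Suc j) > 0"
    using assms by (simp_all del: binomial_Suc_Suc)
  have "(Suc m - j) * (Suc m choose j) = Suc m * (m choose j)"
    using binomial_absorb_comp[of "Suc m" j] by simp
  then have "real (Suc m - j) * real (Suc m choose j) = real (Suc m) * real (m choose j)"
    by (metis of_nat_mult)
  then have a: "real (m choose j) / real (Suc m choose j) = (real m + 1 - real j) / real (m + 1)"
    using p assms by (simp add: divide_simps mult_ac add_ac del: binomial_Suc_Suc)
  have "Suc m * (m choose j) = (Suc m choose Suc j) * Suc j"
    by (rule Suc_times_binomial_eq)
  then have "real (Suc m) * real (m choose j) = real (Suc m choose Suc j) * real (Suc j)"
    by (metis of_nat_mult)
  then have b: "real (m choose j) / real (Suc m choose Suc j) = (real j + 1) / real (m + 1)"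
    using p by (simp add: divide_simps mult_ac del: binomial_Suc_Suc)
  have "real (m choose j) * (1 / real (Suc m choose j) + 1 / real (Suc m choose Suc j))
      = (real m + 1 - real j) / real (m + 1) + (real j + 1) / real (m + 1)"
    unfolding a[symmetric] b[symmetric] by (simp add: distrib_left del: binomial_Suc_Suc)
  then show ?thesis by (simp add: add_divide_distrib[symmetric] del: binomial_Suc_Suc)
qed

lemma sum_occupation:
  assumes "finite A" "x \<in> A"
  shows "(\<Sum>\<eta>\<in>configs_on A (Suc j). real (\<eta> x) * g \<eta>)
       = (\<Sum>\<eta>\<in>configs_on (A - {x}) j. g (\<eta>(x := 1)))"
proof -
  have A: "insert x (A - {x}) = A" using assms by auto
  have "(\<Sum>\<eta>\<in>configs_on (A - {x}) (Suc j). real (\<eta> x) * g \<eta>) = 0"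
    by (intro sum.neutral) (auto simp: configs_on_def)
  then show ?thesis
    using sum_configs_on_split[of "A - {x}" x "\<lambda>\<eta>. real (\<eta> x) * g \<eta>" j] assms
    unfolding A by simp
qed

text \<open>Configurations with \<open>x\<close> occupied are counted, minus those where
  \<open>y\<close> is vacant. Pascal's rule would give \<open>m choose (j - 1)\<close>; the
  difference also covers \<open>j = 0\<close>.\<close>

lemma sum_occupation_pair:
  assumes "finite A" "x \<in> A" "y \<in> A" "x \<noteq> y" "card A = Suc (Suc m)"
  shows "(\<Sum>\<eta>\<in>configs_on A (Suc j). real (\<eta> x) * real (\<eta> y))
       = real (Suc m choose j) - real (m choose j)"
proof -
  let ?B = "A - {x} - {y}"
  have B: "insert y ?B = A - {x}" using assms by auto
  have c: "card ?B = m" using assms by simp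
  have "(\<Sum>\<eta>\<in>configs_on A (Suc j). real (\<eta> x) * real (\<eta> y))
      = (\<Sum>\<eta>\<in>configs_on (A - {x}) j. real (\<eta> y))"
    using sum_occupation[of A x "\<lambda>\<eta>. real (\<eta> y)" j] assms by simp
  also have "\<dots> = (\<Sum>\<eta>\<in>configs_on (A - {x}) j. 1 - (if \<eta> y = 0 then 1 else 0))"
  proof (intro sum.cong refl)
    fix \<eta> assume "\<eta> \<in> configs_on (A - {x}) j"
    from configs_on_01[OF this, of y] show "real (\<eta> y) = 1 - (if \<eta> y = 0 then 1 else 0)" by auto
  qed
  also have "\<dots> = real (card (configs_on (A - {x}) j))
      - real (card {\<eta> \<in> configs_on (A - {x}) j. \<eta> y = 0})"
    using finite_configs_on[of "A - {x}" j] assms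
    by (simp add: sum_subtractf sum.If_cases Int_def)
  also have "{\<eta> \<in> configs_on (A - {x}) j. \<eta> y = 0} = configs_on ?B j"
    using vacant_eq[of ?B y j] assms unfolding B by simp
  finally show ?thesis
    using card_configs_on[of ?B j] card_configs_on[of "A - {x}" j] c assms by simp
qed

text \<open>
  Averaging over the site \<open>x\<close> the decomposition of the variance along the value of \<open>\<eta> x\<close> gains a
  factor \<open>card A\<close>, because the projections onto the individual sites are almost orthogonal.
\<close>

lemma exchange_gap_step:
  fixes A :: "nat set"
  assumes A: "finite A" "card A = Suc (Suc m)" and m: "m > 0" and j: "j \<le> m"
  and IH: "\<And>x k g. x \<in> A \<Longrightarrow> 4 * real (Suc m) * sq_dev g (configs_on (A - {x}) k) \<le>
    (\<Sum>y\<in>A - {x}. \<Sum>z\<in>A - {x}. \<Sum>\<eta>\<in>configs_on (A - {x}) k. (g (exchange y z \<eta>) - g \<eta>)\<^sup>2)"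
  shows "4 * real (card A) * sq_dev f (configs_on A (Suc j)) \<le>
    (\<Sum>x\<in>A. \<Sum>y\<in>A. \<Sum>\<eta>\<in>configs_on A (Suc j). (f (exchange x y \<eta>) - f \<eta>)\<^sup>2)"
proof -
  define X where "X = configs_on A (Suc j)"
  define h where "h \<eta> = f \<eta> - (\<Sum>\<xi>\<in>X. f \<xi>) / card X" for \<eta>
  define e where "e y z = (\<Sum>\<eta>\<in>X. (f (exchange y z \<eta>) - f \<eta>)\<^sup>2)" for y z
  define E where "E = (\<Sum>y\<in>A. \<Sum>z\<in>A. e y z)"
  define V where "V = sq_dev f X"
  \<comment> \<open>\<open>s x\<close> is the unnormalised covariance of \<open>f\<close> with the
    occupation of \<open>x\<close>.\<close>
  define s where "s x = (\<Sum>\<eta>\<in>X. real (\<eta> x) * h \<eta>)" for x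
  define T where "T = (\<Sum>x\<in>A. (s x)\<^sup>2)"
  \<comment> \<open>\<open>M1\<close> and \<open>M0\<close> are the class sizes for \<open>x\<close>
    occupied and vacant; \<open>D\<close> is the eigenvalue of the Gram matrix of the occupations on
    vectors with sum zero.\<close>
  define M1 M0 D where "M1 = real (Suc m choose j)" and "M0 = real (Suc m choose Suc j)"
    and "D = real (m choose j)"
  define P where "P x = sq_dev (\<lambda>\<eta>. h (\<eta>(x := 1))) (configs_on (A - {x}) j)
    + sq_dev h (configs_on (A - {x}) (Suc j))" for x
  have pos: "M1 > 0" "M0 > 0" "D > 0" using j by (simp_all add: M1_def M0_def D_def del: binomial_Suc_Suc)
  have finX: "finite X" using finite_configs_on A by (simp add: X_def)
  have "X \<noteq> {}"
    using card_configs_on[OF A(1), of "Suc j"] j A(2) by (auto simp: X_def simp del: binomial_Suc_Suc)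
  then have cX: "real (card X) > 0" using finX by (simp add: card_gt_0_iff)
  have sumh: "(\<Sum>\<eta>\<in>X. h \<eta>) = 0"
    using cX by (simp add: h_def sum_subtractf)
  have V: "V = (\<Sum>\<eta>\<in>X. (h \<eta>)\<^sup>2)"
    by (simp add: V_def sq_dev_def h_def)
  have insA: "insert x (A - {x}) = A" if "x \<in> A" for x using that by auto
  have cardx: "card (configs_on (A - {x}) i) = (Suc m choose i)" if "x \<in> A" for x i
    using card_configs_on[of "A - {x}" i] A that by simp
  have finx: "finite (configs_on (A - {x}) i)" for x i
    using finite_configs_on A by simp
  have split: "(\<Sum>\<eta>\<in>X. g \<eta>) = (\<Sum>\<eta>\<in>configs_on (A - {x}) j. g (\<eta>(x := 1)))
      + (\<Sum>\<eta>\<in>configs_on (A - {x}) (Suc j). g \<eta>)" if "x \<in> A" for x and g :: "_ \<Rightarrow> real"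
    using sum_configs_on_split[of "A - {x}" x g j] insA[OF that] A unfolding X_def by simp
  have s_eq: "s x = (\<Sum>\<eta>\<in>configs_on (A - {x}) j. h (\<eta>(x := 1)))" if "x \<in> A" for x
    using sum_occupation[of A x h j] A that by (simp add: s_def X_def)
  \<comment> \<open>Splitting by the value at \<open>x\<close>: \<open>P x\<close> is the part
    within the two classes. As \<open>h\<close> sums to zero, the class totals are
    \<open>s x\<close> and \<open>- s x\<close>, which gives the part between them.\<close>
  have V_eq: "V = P x + (1 / M1 + 1 / M0) * (s x)\<^sup>2" if x: "x \<in> A" for x
  proof -
    have s0: "(\<Sum>\<eta>\<in>configs_on (A - {x}) (Suc j). h \<eta>) = - s x"
      using split[OF x, of h] sumh s_eq[OF x] by simp
    have "sq_dev (\<lambda>\<eta>. h (\<eta>(x := 1))) (configs_on (A - {x}) j)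
        = (\<Sum>\<eta>\<in>configs_on (A - {x}) j. (h (\<eta>(x := 1)))\<^sup>2) - (s x)\<^sup>2 / M1"
      using sq_dev_shift[OF finx, of "\<lambda>\<eta>. h (\<eta>(x := 1))" x j 0] cardx[OF x, of j] s_eq[OF x]
      by (simp add: M1_def)
    moreover have "sq_dev h (configs_on (A - {x}) (Suc j))
        = (\<Sum>\<eta>\<in>configs_on (A - {x}) (Suc j). (h \<eta>)\<^sup>2) - (s x)\<^sup>2 / M0"
      using sq_dev_shift[OF finx, of h x "Suc j" 0] cardx[OF x, of "Suc j"] s0
      by (simp add: M0_def del: binomial_Suc_Suc)
    ultimately show ?thesis
      using split[OF x, of "\<lambda>\<eta>. (h \<eta>)\<^sup>2"] by (simp add: V P_def distrib_right)
  qed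
  \<comment> \<open>Cauchy-Schwarz for \<open>h\<close> against the linear function \<open>g\<close>
    with coefficients \<open>s x\<close>. The particle number is fixed, so the coefficients sum to
    zero and the squared norm of \<open>g\<close> is exactly \<open>D * T\<close>.\<close>
  have T_le: "T \<le> D * V"
  proof -
    define g where "g \<eta> = (\<Sum>x\<in>A. s x * real (\<eta> x))" for \<eta> :: "nat \<Rightarrow> nat"
    have "T = (\<Sum>x\<in>A. \<Sum>\<eta>\<in>X. s x * (real (\<eta> x) * h \<eta>))"
      by (simp add: T_def power2_eq_square s_def sum_distrib_left)
    also have "\<dots> = (\<Sum>\<eta>\<in>X. h \<eta> * g \<eta>)"
      by (subst sum.swap) (simp add: g_def sum_distrib_left mult_ac)
    finally have Tg: "T = (\<Sum>\<eta>\<in>X. h \<eta> * g \<eta>)" .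
    have sums: "(\<Sum>x\<in>A. s x) = 0"
    proof -
      have "(\<Sum>x\<in>A. s x) = (\<Sum>\<eta>\<in>X. (\<Sum>x\<in>A. real (\<eta> x)) * h \<eta>)"
        unfolding s_def by (subst sum.swap) (simp add: sum_distrib_right)
      also have "\<dots> = (\<Sum>\<eta>\<in>X. real (Suc j) * h \<eta>)"
      proof (intro sum.cong refl)
        fix \<eta> assume "\<eta> \<in> X"
        then have "(\<Sum>x\<in>A. \<eta> x) = Suc j" by (simp add: X_def configs_on_def)
        then show "(\<Sum>x\<in>A. real (\<eta> x)) * h \<eta> = real (Suc j) * h \<eta>"
          by (metis of_nat_sum)
      qed
      also have "\<dots> = 0" by (simp only: sum_distrib_left[symmetric] sumh mult_zero_right)
      finally show ?thesis .
    qed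
    have "(\<Sum>\<eta>\<in>X. (g \<eta>)\<^sup>2)
        = (\<Sum>\<eta>\<in>X. \<Sum>x\<in>A. \<Sum>y\<in>A. s x * s y * (real (\<eta> x) * real (\<eta> y)))"
      by (simp add: g_def power2_eq_square sum_product mult_ac)
    also have "\<dots> = (\<Sum>x\<in>A. \<Sum>y\<in>A. s x * s y * (\<Sum>\<eta>\<in>X. real (\<eta> x) * real (\<eta> y)))"
      by (subst sum.swap, intro sum.cong refl, subst sum.swap) (simp add: sum_distrib_left)
    also have "\<dots> = (\<Sum>x\<in>A. \<Sum>y\<in>A. s x * s y * (M1 - D) + (if x = y then D * (s x)\<^sup>2 else 0))"
    proof (intro sum.cong refl)
      fix x y assume xy: "x \<in> A" "y \<in> A"
      show "s x * s y * (\<Sum>\<eta>\<in>X. real (\<eta> x) * real (\<eta> y))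
          = s x * s y * (M1 - D) + (if x = y then D * (s x)\<^sup>2 else 0)"
      proof (cases "x = y")
        case True
        have "(\<Sum>\<eta>\<in>X. real (\<eta> x) * real (\<eta> x)) = M1"
          using sum_occupation[of A x "\<lambda>\<eta>. real (\<eta> x)" j] A xy cardx[OF xy(1), of j]
          by (simp add: X_def M1_def)
        then show ?thesis using True by (simp add: power2_eq_square algebra_simps)
      next
        case False
        then show ?thesis
          using sum_occupation_pair[OF A(1) xy False A(2), of j]
          by (simp add: X_def M1_def D_def)
      qed
    qed
    also have "\<dots> = (M1 - D) * (\<Sum>x\<in>A. s x)\<^sup>2 + D * T"
      using A(1) by (simp add: sum.distrib sum_distrib_left sum_distrib_right T_def
          power2_eq_square sum_product mult_ac)
    finally have g2: "(\<Sum>\<eta>\<in>X. (g \<eta>)\<^sup>2) = D * T" using sums by simp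
    have "T\<^sup>2 \<le> V * (D * T)"
      using Cauchy_Schwarz_ineq_sum[of h g X] Tg g2 V by simp
    moreover have "T \<ge> 0" by (simp add: T_def sum_nonneg)
    moreover have "V \<ge> 0" by (simp add: V sum_nonneg)
    ultimately show ?thesis
      using pos by (cases "T = 0") (auto simp: power2_eq_square mult_ac)
  qed
  \<comment> \<open>An exchange of two sites other than \<open>x\<close> preserves each class, so
    the induction hypothesis applies to both, with \<open>j\<close> and \<open>Suc j\<close>
    particles left.\<close>
  have P_le: "4 * real (Suc m) * P x \<le> (\<Sum>y\<in>A - {x}. \<Sum>z\<in>A - {x}. e y z)" if x: "x \<in> A" for x
  proof -
    have "4 * real (Suc m) * P x \<le>
        (\<Sum>y\<in>A - {x}. \<Sum>z\<in>A - {x}. \<Sum>\<eta>\<in>configs_on (A - {x}) j.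
           (h ((exchange y z \<eta>)(x := 1)) - h (\<eta>(x := 1)))\<^sup>2)
      + (\<Sum>y\<in>A - {x}. \<Sum>z\<in>A - {x}. \<Sum>\<eta>\<in>configs_on (A - {x}) (Suc j).
           (h (exchange y z \<eta>) - h \<eta>)\<^sup>2)"
      unfolding P_def distrib_left by (intro add_mono IH x)
    also have "\<dots> = (\<Sum>y\<in>A - {x}. \<Sum>z\<in>A - {x}. e y z)"
      unfolding sum.distrib[symmetric]
    proof (intro sum.cong refl)
      fix y z assume yz: "y \<in> A - {x}" "z \<in> A - {x}"
      show "(\<Sum>\<eta>\<in>configs_on (A - {x}) j. (h ((exchange y z \<eta>)(x := 1)) - h (\<eta>(x := 1)))\<^sup>2)
          + (\<Sum>\<eta>\<in>configs_on (A - {x}) (Suc j). (h (exchange y z \<eta>) - h \<eta>)\<^sup>2) = e y z"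
        using yz unfolding e_def split[OF x] by (simp add: exchange_upd h_def)
    qed
    finally show ?thesis .
  qed
  \<comment> \<open>A pair of distinct sites is retained for exactly \<open>m\<close> of the
    \<open>m + 2\<close> choices of \<open>x\<close>; pairs with \<open>y = z\<close> contribute
    nothing.\<close>
  have sumP: "4 * real (Suc m) * (\<Sum>x\<in>A. P x) \<le> real m * E"
  proof -
    have e0: "e y y = 0" for y by (simp add: e_def)
    have "4 * real (Suc m) * (\<Sum>x\<in>A. P x) \<le> (\<Sum>x\<in>A. \<Sum>y\<in>A - {x}. \<Sum>z\<in>A - {x}. e y z)"
      unfolding sum_distrib_left by (intro sum_mono P_le)
    also have "\<dots> = (\<Sum>x\<in>A. \<Sum>y\<in>A. \<Sum>z\<in>A. if x \<noteq> y \<and> x \<noteq> z then e y z else 0)"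
    proof (rule sum.cong[OF refl])
      fix x
      have "(\<Sum>y\<in>A - {x}. \<Sum>z\<in>A - {x}. e y z) = (\<Sum>y\<in>A. if x \<noteq> y then \<Sum>z\<in>A - {x}. e y z else 0)"
        using A by (intro sum.mono_neutral_cong_left) auto
      also have "\<dots> = (\<Sum>y\<in>A. \<Sum>z\<in>A. if x \<noteq> y \<and> x \<noteq> z then e y z else 0)"
      proof (intro sum.cong refl)
        fix y
        have "(\<Sum>z\<in>A - {x}. e y z) = (\<Sum>z\<in>A. if x \<noteq> z then e y z else 0)"
          using A by (intro sum.mono_neutral_cong_left) auto
        then show "(if x \<noteq> y then \<Sum>z\<in>A - {x}. e y z else 0)
            = (\<Sum>z\<in>A. if x \<noteq> y \<and> x \<noteq> z then e y z else 0)" by simp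
      qed
      finally show "(\<Sum>y\<in>A - {x}. \<Sum>z\<in>A - {x}. e y z)
          = (\<Sum>y\<in>A. \<Sum>z\<in>A. if x \<noteq> y \<and> x \<noteq> z then e y z else 0)" .
    qed
    also have "\<dots> = (\<Sum>y\<in>A. \<Sum>z\<in>A. \<Sum>x\<in>A. if x \<noteq> y \<and> x \<noteq> z then e y z else 0)"
      by (subst sum.swap, rule sum.cong[OF refl], rule sum.swap)
    also have "\<dots> = (\<Sum>y\<in>A. \<Sum>z\<in>A. real m * e y z)"
    proof (intro sum.cong refl)
      fix y z assume yz: "y \<in> A" "z \<in> A"
      show "(\<Sum>x\<in>A. if x \<noteq> y \<and> x \<noteq> z then e y z else 0) = real m * e y z"
      proof (cases "y = z")
        case True
        then have "e y z = 0" using e0 by simp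
        then show ?thesis by (auto intro!: sum.neutral)
      next
        case False
        have "(\<Sum>x\<in>A. if x \<noteq> y \<and> x \<noteq> z then e y z else 0) = (\<Sum>x\<in>A - {y, z}. e y z)"
          using A by (intro sum.mono_neutral_cong_right) auto
        moreover have "card (A - {y, z}) = m" using A yz False by (simp add: card_Diff_subset)
        ultimately show ?thesis by simp
      qed
    qed
    finally show ?thesis by (simp add: E_def sum_distrib_left)
  qed
  have "real (m + 2) * V = (\<Sum>x\<in>A. P x) + (1 / M1 + 1 / M0) * T"
  proof -
    have "real (m + 2) * V = (\<Sum>x\<in>A. V)" using A by simp
    also have "\<dots> = (\<Sum>x\<in>A. P x + (1 / M1 + 1 / M0) * (s x)\<^sup>2)"
      by (intro sum.cong refl V_eq)
    finally show ?thesis by (simp add: sum.distrib T_def sum_distrib_left)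
  qed
  \<comment> \<open>Almost orthogonality: of the \<open>m + 2\<close> copies of \<open>V\<close>,
    the parts between classes together take up at most \<open>(m + 2) / (m + 1)\<close>.\<close>
  also have "(1 / M1 + 1 / M0) * T \<le> (1 / M1 + 1 / M0) * (D * V)"
    using pos T_le by (intro mult_left_mono) auto
  also have "\<dots> = real (m + 2) / real (m + 1) * V"
    using binomial_ratio_sum[OF j] unfolding M1_def M0_def D_def by (simp only: mult_ac)
  finally have "real (m + 2) * V \<le> (\<Sum>x\<in>A. P x) + real (m + 2) / real (m + 1) * V" by simp
  then have "4 * real (Suc m) * (real (m + 2) * V)
      \<le> 4 * real (Suc m) * ((\<Sum>x\<in>A. P x) + real (m + 2) / real (m + 1) * V)"
    by (intro mult_left_mono) auto
  also have "\<dots> = 4 * real (Suc m) * (\<Sum>x\<in>A. P x) + 4 * real (m + 2) * V"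
    by (simp add: field_simps)
  also have "\<dots> \<le> real m * E + 4 * real (m + 2) * V" using sumP by simp
  \<comment> \<open>Here \<open>(m + 1) * (m + 2) - (m + 2) = m * (m + 2)\<close>, and
    \<open>m\<close> then cancels on both sides.\<close>
  finally have "real m * (4 * real (m + 2) * V) \<le> real m * E"
    by (simp add: algebra_simps)
  then have "4 * real (m + 2) * V \<le> E" using m by simp
  then show ?thesis using A by (simp add: V_def E_def e_def X_def)
qed

text \<open>Poincare inequality of the Bernoulli-Laplace model, by induction on the number of sites.
  If \<open>k = 0\<close> or \<open>k\<close> is at least the number of sites, there is at most one
  configuration and the variance vanishes.\<close>

theorem exchange_gap:
  assumes "finite A"
  shows "4 * real (card A) * sq_dev f (configs_on A k) \<le>
    (\<Sum>x\<in>A. \<Sum>y\<in>A. \<Sum>\<eta>\<in>configs_on A k. (f (exchange x y \<eta>) - f \<eta>)\<^sup>2)"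
  using assms
proof (induction "card A" arbitrary: A k f)
  case 0
  then show ?case by simp
next
  case (Suc n)
  show ?case
  proof (cases "k = 0 \<or> card A \<le> k")
    case True
    then have "card (configs_on A k) \<le> 1"
      using card_configs_on[OF Suc.prems, of k] by (cases "card A = k") (auto simp: binomial_eq_0)
    then have "sq_dev f (configs_on A k) = 0"
      using sq_dev_card_le_1 finite_configs_on Suc.prems by blast
    then show ?thesis by (simp add: sum_nonneg)
  next
    case False
    then obtain j where k: "k = Suc j" by (cases k) auto
    obtain m where n: "n = Suc m"
      using False Suc.hyps(2) by (cases n) auto
    have j: "j \<le> m" using False k n Suc.hyps(2) by simp
    show ?thesis
    proof (cases "m = 0")
      case True
      then have "card A = 2" using n Suc.hyps(2) by simp
      then obtain a b where ab: "A = {a, b}" "a \<noteq> b" by (auto simp: card_2_iff)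
      have "k = 1" using j True k by simp
      then show ?thesis using exchange_gap_doubleton[OF ab(2), of f] \<open>card A = 2\<close> ab(1) by simp
    next
      case False
      have c: "card A = Suc (Suc m)" using n Suc.hyps(2) by simp
      show ?thesis unfolding k
      proof (rule exchange_gap_step[OF Suc.prems c _ j])
        fix x k and g :: "(nat \<Rightarrow> nat) \<Rightarrow> real" assume "x \<in> A"
        then have "n = card (A - {x})" using Suc.hyps(2) Suc.prems by simp
        from Suc.hyps(1)[OF this, of g k]
        show "4 * real (Suc m) * sq_dev g (configs_on (A - {x}) k) \<le>
          (\<Sum>y\<in>A - {x}. \<Sum>z\<in>A - {x}. \<Sum>\<eta>\<in>configs_on (A - {x}) k. (g (exchange y z \<eta>) - g \<eta>)\<^sup>2)"
          using Suc.prems n \<open>n = card (A - {x})\<close> by simp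
      qed (use False in simp)
    qed
  qed
qed

section \<open>Exchanging sites along paths\<close>

lemma L2_set_reindex:
  "bij_betw p A B \<Longrightarrow> L2_set (\<lambda>x. g (p x)) A = L2_set g B"
  unfolding L2_set_def by (subst sum.reindex_bij_betw[symmetric]) auto

lemma L2_set_diff_triangle:
  "L2_set (\<lambda>x. f x - h x) A \<le> L2_set (\<lambda>x. f x - g x) A + L2_set (\<lambda>x. g x - h x) A"
  using L2_set_triangle_ineq[of "\<lambda>x. f x - g x" "\<lambda>x. g x - h x" A] by simp

lemma L2_set_diff_commute: "L2_set (\<lambda>x. f x - g x) A = L2_set (\<lambda>x. g x - f x) A"
  by (simp add: L2_set_def power2_commute)

lemma L2_set_power2: "(L2_set f A)\<^sup>2 = (\<Sum>x\<in>A. (f x)\<^sup>2)"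
  by (simp add: L2_set_def sum_nonneg)

lemma L2_set_path:
  fixes F :: "nat \<Rightarrow> 'a \<Rightarrow> real"
  assumes "x \<le> y"
  shows "L2_set (\<lambda>\<eta>. F y \<eta> - F x \<eta>) X \<le> (\<Sum>v = x..<y. L2_set (\<lambda>\<eta>. F (Suc v) \<eta> - F v \<eta>) X)"
  using assms
proof (induction y rule: dec_induct)
  case base
  show ?case by (simp add: L2_set_def)
next
  case (step y)
  then show ?case
    using L2_set_diff_triangle[of "F (Suc y)" "F x" X "F y"] by simp
qed

text \<open>
  Sites are exchanged at distance by carrying a particle step by step: \<open>F v\<close> is to be thought of as the
  observable seen when an auxiliary device, needed to exchange \<open>v\<close> and \<open>Suc v\<close>, sits at \<open>v\<close>.
\<close>

lemma exchange_path:
  fixes F :: "nat \<Rightarrow> (nat \<Rightarrow> nat) \<Rightarrow> real"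
  defines "R \<equiv> \<lambda>X v. L2_set (\<lambda>\<eta>. F (Suc v) \<eta> - F v \<eta>) X"
    and "S \<equiv> \<lambda>X v. L2_set (\<lambda>\<eta>. F v (exchange v (Suc v) \<eta>) - F v \<eta>) X"
  assumes inv: "\<And>x y. x \<in> A \<Longrightarrow> y \<in> A \<Longrightarrow> exchange x y ` X \<subseteq> X"
    and "{x..y} \<subseteq> A" "x \<le> y"
  shows "L2_set (\<lambda>\<eta>. F y (exchange x y \<eta>) - F y \<eta>) X \<le> 2 * (\<Sum>v = x..<y. R X v + S X v)"
  using assms(5,4)
proof (induction y rule: dec_induct)
  case base
  show ?case by (simp add: L2_set_def)
next
  case (step y)
  have sub: "{x..y} \<subseteq> A" and yA: "y \<in> A" "Suc y \<in> A" "x \<in> A" using step by auto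
  define q where "q = exchange x (Suc y)"
  have bij: "bij_betw (exchange a b) X X" if "a \<in> A" "b \<in> A" for a b
    using bij_betw_exchange inv[OF that] by blast
  have bq: "bij_betw q X X" using bij yA by (simp add: q_def)
  have nn: "R X v \<ge> 0" "S X v \<ge> 0" for v by (simp_all add: R_def S_def)
  \<comment> \<open>Moving the device from \<open>Suc y\<close> to \<open>y\<close> before the
    exchange and back afterwards costs \<open>R X y\<close> twice, because \<open>q\<close> permutes
    \<open>X\<close>.\<close>
  have A: "L2_set (\<lambda>\<eta>. F (Suc y) (q \<eta>) - F (Suc y) \<eta>) X
      \<le> 2 * R X y + L2_set (\<lambda>\<eta>. F y (q \<eta>) - F y \<eta>) X"
  proof -
    have "L2_set (\<lambda>\<eta>. F (Suc y) (q \<eta>) - F y (q \<eta>)) X = R X y"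
      using L2_set_reindex[OF bq, of "\<lambda>\<eta>. F (Suc y) \<eta> - F y \<eta>"] by (simp add: R_def)
    moreover have "L2_set (\<lambda>\<eta>. F y \<eta> - F (Suc y) \<eta>) X = R X y"
      unfolding R_def by (rule L2_set_diff_commute)
    ultimately show ?thesis
      using L2_set_diff_triangle[of "\<lambda>\<eta>. F (Suc y) (q \<eta>)" "F (Suc y)" X "\<lambda>\<eta>. F y (q \<eta>)"]
        L2_set_diff_triangle[of "\<lambda>\<eta>. F y (q \<eta>)" "F (Suc y)" X "F y"] by linarith
  qed
  have B: "L2_set (\<lambda>\<eta>. F y (q \<eta>) - F y \<eta>) X
      \<le> 2 * S X y + 2 * (\<Sum>v = x..<y. R X v + S X v)"
  proof (cases "x = y")
    case True
    then show ?thesis using nn[of y] by (simp add: q_def S_def)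
  next
    case False
    \<comment> \<open>Conjugation: the neighbours are exchanged first and last, with the shorter
      exchange \<open>p\<close> in between. The device stays at \<open>y\<close>, where the
      induction hypothesis speaks about \<open>p\<close>.\<close>
    define t where "t = exchange y (Suc y)"
    define p where "p = exchange x y"
    have q: "q \<eta> = t (p (t \<eta>))" for \<eta>
      using False step.hyps by (auto simp: q_def t_def p_def exchange_apply fun_eq_iff)
    have bt: "bij_betw t X X" and bp: "bij_betw p X X" using bij yA by (auto simp: t_def p_def)
    have "L2_set (\<lambda>\<eta>. F y (t (p (t \<eta>))) - F y (p (t \<eta>))) X = S X y"
      using L2_set_reindex[OF bij_betw_trans[OF bt bp], of "\<lambda>\<eta>. F y (t \<eta>) - F y \<eta>"]
      by (simp add: S_def t_def)
    moreover have "L2_set (\<lambda>\<eta>. F y (p (t \<eta>)) - F y (t \<eta>)) X = L2_set (\<lambda>\<eta>. F y (p \<eta>) - F y \<eta>) X"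
      using L2_set_reindex[OF bt, of "\<lambda>\<eta>. F y (p \<eta>) - F y \<eta>"] .
    moreover have "L2_set (\<lambda>\<eta>. F y (t \<eta>) - F y \<eta>) X = S X y"
      by (simp add: S_def t_def)
    moreover have "L2_set (\<lambda>\<eta>. F y (p \<eta>) - F y \<eta>) X \<le> 2 * (\<Sum>v = x..<y. R X v + S X v)"
      using step.IH[OF sub] by (simp add: p_def)
    ultimately show ?thesis
      using L2_set_diff_triangle[of "\<lambda>\<eta>. F y (q \<eta>)" "F y" X "\<lambda>\<eta>. F y (p (t \<eta>))"]
        L2_set_diff_triangle[of "\<lambda>\<eta>. F y (p (t \<eta>))" "F y" X "\<lambda>\<eta>. F y (t \<eta>)"]
      unfolding q by linarith
  qed
  have "(\<Sum>v = x..<Suc y. R X v + S X v) = (\<Sum>v = x..<y. R X v + S X v) + (R X y + S X y)"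
    using step.hyps by simp
  then show ?case using A B unfolding q_def by linarith
qed

text \<open>Comparison with the complete graph on \<open>n\<close> sites: each exchange has cost at
  most \<open>4 * Z\<close>. Summing the squares over \<open>n^2\<close> ordered pairs and dividing
  by \<open>4 * n\<close> leaves \<open>4 * n * Z^2\<close>.\<close>

lemma sq_dev_exchange_path:
  fixes F :: "nat \<Rightarrow> (nat \<Rightarrow> nat) \<Rightarrow> real" and l m k :: nat
  defines "X \<equiv> configs_on {l..m} k"
  assumes "l \<le> m"
    and Z: "(\<Sum>v = l..<m. L2_set (\<lambda>\<eta>. F (Suc v) \<eta> - F v \<eta>) X) +
      (\<Sum>v = l..<m. L2_set (\<lambda>\<eta>. F v (exchange v (Suc v) \<eta>) - F v \<eta>) X) \<le> Z"
  shows "sq_dev (F l) X \<le> 4 * real (Suc m - l) * Z\<^sup>2"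
proof -
  define R where "R v = L2_set (\<lambda>\<eta>. F (Suc v) \<eta> - F v \<eta>) X" for v
  define S where "S v = L2_set (\<lambda>\<eta>. F v (exchange v (Suc v) \<eta>) - F v \<eta>) X" for v
  define n where "n = real (Suc m - l)"
  have n: "n > 0" using assms(2) by (simp add: n_def)
  have nn: "R v \<ge> 0" "S v \<ge> 0" for v by (simp_all add: R_def S_def)
  have Z': "(\<Sum>v = l..<m. R v) + (\<Sum>v = l..<m. S v) \<le> Z"
    using Z by (simp add: R_def S_def)
  have inv: "exchange x y ` X \<subseteq> X" if "x \<in> {l..m}" "y \<in> {l..m}" for x y
    using exchange_in[of "{l..m}" x y] that by (auto simp: X_def)
  \<comment> \<open>Taking the device from \<open>l\<close> to \<open>y\<close> and back costs at
    most \<open>2 * Z\<close>, and the exchange with the device at \<open>y\<close> another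
    \<open>2 * Z\<close>.\<close>
  have le: "L2_set (\<lambda>\<eta>. F l (exchange x y \<eta>) - F l \<eta>) X \<le> 4 * Z"
    if xy: "x \<in> {l..m}" "y \<in> {l..m}" "x \<le> y" for x y
  proof -
    have Ry: "(\<Sum>v = l..<y. R v) \<le> (\<Sum>v = l..<m. R v)"
      using xy nn by (intro sum_mono2) auto
    have P: "L2_set (\<lambda>\<eta>. F y \<eta> - F l \<eta>) X \<le> (\<Sum>v = l..<m. R v)"
      using L2_set_path[of l y F X] xy Ry by (simp add: R_def)
    have "(\<Sum>v = x..<y. R v + S v) \<le> (\<Sum>v = l..<m. R v + S v)"
      using xy nn by (intro sum_mono2) (auto intro: add_nonneg_nonneg)
    then have Q: "L2_set (\<lambda>\<eta>. F y (exchange x y \<eta>) - F y \<eta>) X \<le> 2 * Z"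
      using exchange_path[of "{l..m}" X x y F, OF inv] xy Z'
      by (force simp: R_def S_def sum.distrib)
    have "bij_betw (exchange x y) X X"
      using bij_betw_exchange inv[OF xy(1,2)] by blast
    then have "L2_set (\<lambda>\<eta>. F l (exchange x y \<eta>) - F y (exchange x y \<eta>)) X
        = L2_set (\<lambda>\<eta>. F y \<eta> - F l \<eta>) X"
      using L2_set_reindex[of "exchange x y" X X "\<lambda>\<eta>. F l \<eta> - F y \<eta>"] L2_set_diff_commute[of "F l" "F y" X]
      by simp
    then show ?thesis
      using L2_set_diff_triangle[of "\<lambda>\<eta>. F l (exchange x y \<eta>)" "F l" X "\<lambda>\<eta>. F y (exchange x y \<eta>)"]
        L2_set_diff_triangle[of "\<lambda>\<eta>. F y (exchange x y \<eta>)" "F l" X "F y"] P Q Z'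
        sum_nonneg[of "{l..<m}" S, OF nn(2)] by linarith
  qed
  have le2: "(\<Sum>\<eta>\<in>X. (F l (exchange x y \<eta>) - F l \<eta>)\<^sup>2) \<le> 16 * Z\<^sup>2"
    if xy: "x \<in> {l..m}" "y \<in> {l..m}" for x y
  proof -
    have "L2_set (\<lambda>\<eta>. F l (exchange x y \<eta>) - F l \<eta>) X \<le> 4 * Z"
      using le[of x y] le[of y x] xy exchange_commute[of x y] by (cases "x \<le> y") auto
    then have "(L2_set (\<lambda>\<eta>. F l (exchange x y \<eta>) - F l \<eta>) X)\<^sup>2 \<le> (4 * Z)\<^sup>2"
      by (rule power_mono) simp
    then show ?thesis by (simp add: L2_set_power2 power_mult_distrib)
  qed
  have "4 * n * sq_dev (F l) X \<le>
      (\<Sum>x\<in>{l..m}. \<Sum>y\<in>{l..m}. \<Sum>\<eta>\<in>X. (F l (exchange x y \<eta>) - F l \<eta>)\<^sup>2)"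
    using exchange_gap[of "{l..m}" "F l" k] by (simp add: n_def X_def)
  also have "\<dots> \<le> (\<Sum>x\<in>{l..m}. \<Sum>y\<in>{l..m}. 16 * Z\<^sup>2)"
    by (intro sum_mono le2)
  also have "\<dots> = 4 * n * (4 * n * Z\<^sup>2)" proof -
    have c: "real (card {l..m}) = n" by (simp add: n_def)
    show ?thesis by (simp add: sum_constant c del: card_atLeastAtMost)
  qed
  finally show ?thesis using n by (simp add: n_def[symmetric])
qed

section \<open>Configurations with a pair of neighbouring particles\<close>

text \<open>The surroundings \<open>\<omega>\<close> live on \<open>{3..N}\<close> for every
  \<open>u\<close>: sites \<open>3\<close> to \<open>u + 1\<close> appear shifted left by two, later
  ones in place. All pair positions thus share one parameter set, on which observables for different
  \<open>u\<close> can be compared.\<close>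

definition insert_pair :: "nat \<Rightarrow> (nat \<Rightarrow> nat) \<Rightarrow> nat \<Rightarrow> nat" where
  "insert_pair u \<omega> = (\<lambda>z. if z < u then \<omega> (z + 2) else if z \<le> Suc u then 1 else \<omega> z)"

text \<open>The content of site \<open>u + 2\<close> passes the pair in two exchanges. Each time a
  particle of the pair sits next to the bond and gives rate at least 1.\<close>

lemma insert_pair_Suc:
  "insert_pair (Suc u) \<omega> =
     exchange u (Suc u) (exchange (Suc u) (Suc (Suc u)) (insert_pair u \<omega>))"
  by (auto simp: insert_pair_def exchange_apply fun_eq_iff)

text \<open>Sites right of the pair are not shifted, so this exchange of the surroundings is one of
  the configuration; the particle at \<open>u + 1\<close> makes its rate at least 1.\<close>

lemma insert_pair_exchange:
  "insert_pair u (exchange (u + 2) (u + 3) \<omega>) = exchange (u + 2) (u + 3) (insert_pair u \<omega>)"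
  by (auto simp: insert_pair_def exchange_apply fun_eq_iff)

lemma sum_insert_pair:
  assumes "1 \<le> u" "Suc u \<le> N"
  shows "(\<Sum>z\<in>{1..N}. insert_pair u \<omega> z) = (\<Sum>z\<in>{3..N}. \<omega> z) + 2"
proof -
  have "{1..N} = {1..<u} \<union> ({u, Suc u} \<union> {u + 2..N})" using assms by auto
  then have "(\<Sum>z\<in>{1..N}. insert_pair u \<omega> z)
      = (\<Sum>z\<in>{1..<u}. insert_pair u \<omega> z) + ((\<Sum>z\<in>{u, Suc u}. insert_pair u \<omega> z)
        + (\<Sum>z\<in>{u + 2..N}. insert_pair u \<omega> z))"
    by (simp only:) (subst sum.union_disjoint, auto intro!: sum.union_disjoint)
  also have "(\<Sum>z\<in>{1..<u}. insert_pair u \<omega> z) = (\<Sum>z\<in>{1..<u}. \<omega> (z + 2))"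
    by (intro sum.cong) (auto simp: insert_pair_def)
  also have "\<dots> = (\<Sum>z\<in>{3..<u + 2}. \<omega> z)"
    using sum.shift_bounds_nat_ivl[of \<omega> 1 2 u] by (simp add: numeral_3_eq_3)
  also have "(\<Sum>z\<in>{u, Suc u}. insert_pair u \<omega> z) = 2" by (simp add: insert_pair_def)
  also have "(\<Sum>z\<in>{u + 2..N}. insert_pair u \<omega> z) = (\<Sum>z\<in>{u + 2..N}. \<omega> z)"
    by (intro sum.cong) (auto simp: insert_pair_def)
  also have "(\<Sum>z\<in>{3..<u + 2}. \<omega> z) + (2 + (\<Sum>z\<in>{u + 2..N}. \<omega> z)) = (\<Sum>z\<in>{3..N}. \<omega> z) + 2"
  proof -
    have "{3..N} = {3..<u + 2} \<union> {u + 2..N}" using assms by auto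
    then have "(\<Sum>z\<in>{3..N}. \<omega> z) = (\<Sum>z\<in>{3..<u + 2}. \<omega> z) + (\<Sum>z\<in>{u + 2..N}. \<omega> z)"
      by (simp only:) (subst sum.union_disjoint, auto)
    then show ?thesis by simp
  qed
  finally show ?thesis .
qed

lemma bij_betw_insert_pair:
  assumes "1 \<le> u" "Suc u \<le> N"
  shows "bij_betw (insert_pair u) (configs_on {3..N} k)
    {\<eta> \<in> configs_on {1..N} (k + 2). \<eta> u = 1 \<and> \<eta> (Suc u) = 1}"
proof -
  \<comment> \<open>The inverse map deletes the pair and moves the part on its left back by two
    sites.\<close>
  define r where "r \<eta> = (\<lambda>z. if z < 3 then 0 else if z < u + 2 then \<eta> (z - 2) else \<eta> z)"
    for \<eta> :: "nat \<Rightarrow> nat"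
  have ri: "r (insert_pair u \<omega>) = \<omega>" if \<omega>: "\<omega> \<in> configs_on {3..N} k" for \<omega>
  proof
    fix z
    have "\<omega> z = 0" if "z < 3" using that \<omega> by (simp add: configs_on_def)
    moreover have "Suc (Suc (z - 2)) = z" if "\<not> z < 3" using that by simp
    ultimately show "r (insert_pair u \<omega>) z = \<omega> z"
      using assms by (cases "z < 3") (auto simp: r_def insert_pair_def)
  qed
  have ir: "insert_pair u (r \<eta>) = \<eta>"
    if \<eta>: "\<eta> \<in> configs_on {1..N} (k + 2)" "\<eta> u = 1" "\<eta> (Suc u) = 1" for \<eta>
  proof
    fix z
    have "\<eta> 0 = 0" using \<eta> by (simp add: configs_on_def)
    moreover have "z < u \<or> z = u \<or> z = Suc u \<or> u + 2 \<le> z" by linarith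
    ultimately show "insert_pair u (r \<eta>) z = \<eta> z"
      using assms \<eta> by (cases "z = 0") (auto simp: r_def insert_pair_def)
  qed
  show ?thesis
  proof (rule bij_betw_byWitness[where f' = r])
    show "\<forall>\<omega>\<in>configs_on {3..N} k. r (insert_pair u \<omega>) = \<omega>" using ri by blast
    show "\<forall>\<eta>\<in>{\<eta> \<in> configs_on {1..N} (k + 2). \<eta> u = 1 \<and> \<eta> (Suc u) = 1}. insert_pair u (r \<eta>) = \<eta>"
      using ir by blast
    show "insert_pair u ` configs_on {3..N} k
        \<subseteq> {\<eta> \<in> configs_on {1..N} (k + 2). \<eta> u = 1 \<and> \<eta> (Suc u) = 1}"
    proof safe
      fix \<omega> assume \<omega>: "\<omega> \<in> configs_on {3..N} k"
      have "insert_pair u \<omega> z \<in> {0, 1}" for z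
        using configs_on_01[OF \<omega>] by (simp add: insert_pair_def)
      moreover have "insert_pair u \<omega> z = 0" if "z \<notin> {1..N}" for z
        using \<omega> that assms by (cases "z = 0") (auto simp: insert_pair_def configs_on_def)
      moreover have "(\<Sum>z\<in>{3..N}. \<omega> z) = k" using \<omega> by (simp add: configs_on_def)
      ultimately show "insert_pair u \<omega> \<in> configs_on {1..N} (k + 2)"
        using sum_insert_pair[OF assms, of \<omega>] unfolding configs_on_def by auto
    qed (simp_all add: insert_pair_def)
    show "r ` {\<eta> \<in> configs_on {1..N} (k + 2). \<eta> u = 1 \<and> \<eta> (Suc u) = 1} \<subseteq> configs_on {3..N} k"
    proof safe
      fix \<eta> assume \<eta>: "\<eta> \<in> configs_on {1..N} (k + 2)" "\<eta> u = 1" "\<eta> (Suc u) = 1"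
      have "r \<eta> z \<in> {0, 1}" for z
        using configs_on_01[OF \<eta>(1)] by (simp add: r_def)
      moreover have "r \<eta> z = 0" if "z \<notin> {3..N}" for z
        using \<eta>(1) that assms by (auto simp: r_def configs_on_def)
      moreover have "(\<Sum>z\<in>{1..N}. \<eta> z) = k + 2" using \<eta> by (simp add: configs_on_def)
      ultimately show "r \<eta> \<in> configs_on {3..N} k"
        using sum_insert_pair[OF assms, of "r \<eta>"] ir[OF \<eta>] unfolding configs_on_def by auto
    qed
  qed
qed

section \<open>Energies of single bonds and the cost of one jump\<close>

definition exchange_energy ::
    "((nat \<Rightarrow> nat) \<Rightarrow> real) \<Rightarrow> (nat \<Rightarrow> nat) set \<Rightarrow> ((nat \<Rightarrow> nat) \<Rightarrow> real) \<Rightarrow> nat \<Rightarrow> real" where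
  "exchange_energy c X f z = (\<Sum>\<eta>\<in>X. c \<eta> * (f (exchange z (Suc z) \<eta>) - f \<eta>)\<^sup>2)"

text \<open>One step of a path: injectivity of \<open>p\<close> uses each term of the energy at most
  once, and weight at least 1 on the starting configurations allows the weight to be
  inserted.\<close>

lemma L2_set_exchange_le:
  assumes "finite X" "inj_on p Y" "p ` Y \<subseteq> X"
    and "\<And>\<eta>. \<eta> \<in> X \<Longrightarrow> c \<eta> \<ge> 0" "\<And>\<omega>. \<omega> \<in> Y \<Longrightarrow> c (p \<omega>) \<ge> 1"
  shows "L2_set (\<lambda>\<omega>. f (exchange z (Suc z) (p \<omega>)) - f (p \<omega>)) Y \<le> sqrt (exchange_energy c X f z)"
proof -
  have "(\<Sum>\<omega>\<in>Y. (f (exchange z (Suc z) (p \<omega>)) - f (p \<omega>))\<^sup>2)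
      = (\<Sum>\<eta>\<in>p ` Y. (f (exchange z (Suc z) \<eta>) - f \<eta>)\<^sup>2)"
    using assms(2) by (simp add: sum.reindex)
  also have "\<dots> \<le> (\<Sum>\<eta>\<in>p ` Y. c \<eta> * (f (exchange z (Suc z) \<eta>) - f \<eta>)\<^sup>2)"
  proof (rule sum_mono)
    fix \<eta> assume "\<eta> \<in> p ` Y"
    then have "1 \<le> c \<eta>" using assms(5) by auto
    then show "(f (exchange z (Suc z) \<eta>) - f \<eta>)\<^sup>2 \<le> c \<eta> * (f (exchange z (Suc z) \<eta>) - f \<eta>)\<^sup>2"
      using mult_right_mono[of 1 "c \<eta>" "(f (exchange z (Suc z) \<eta>) - f \<eta>)\<^sup>2"] by simp
  qed
  also have "\<dots> \<le> exchange_energy c X f z"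
    unfolding exchange_energy_def using assms by (intro sum_mono2) auto
  finally show ?thesis unfolding L2_set_def by (rule real_sqrt_le_mono)
qed

lemma exchange_energy_nonneg:
  "(\<And>\<eta>. \<eta> \<in> X \<Longrightarrow> c \<eta> \<ge> 0) \<Longrightarrow> exchange_energy c X f z \<ge> 0"
  unfolding exchange_energy_def by (intro sum_nonneg) auto

lemma sum_sqrt_le:
  fixes q :: "nat \<Rightarrow> real"
  assumes "finite A" "\<And>z. z \<in> A \<Longrightarrow> q z \<ge> 0"
  shows "(\<Sum>z\<in>A. sqrt (q z))\<^sup>2 \<le> real (card A) * (\<Sum>z\<in>A. q z)"
proof -
  have "(\<Sum>z\<in>A. sqrt (q z))\<^sup>2 \<le> (\<Sum>z\<in>A. 1\<^sup>2) * (\<Sum>z\<in>A. (sqrt (q z))\<^sup>2)"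
    using Cauchy_Schwarz_ineq_sum[of "\<lambda>_. 1" "\<lambda>z. sqrt (q z)" A] by simp
  also have "(\<Sum>z\<in>A. (sqrt (q z))\<^sup>2) = (\<Sum>z\<in>A. q z)"
    using assms(2) by (intro sum.cong) auto
  finally show ?thesis by simp
qed

text \<open>Contribution of one bond to the Dirichlet form from the degenerate porous medium rates,
  without the factor \<open>1 / 2\<close> and the normalisation by
  \<open>N choose k\<close>.\<close>

definition pmm_energy :: "nat \<Rightarrow> nat \<Rightarrow> ((nat \<Rightarrow> nat) \<Rightarrow> real) \<Rightarrow> nat \<Rightarrow> real" where
  "pmm_energy N k f z =
     exchange_energy (\<lambda>\<eta>. real (pmm_rate z (Suc z) \<eta>)) (configs_on {1..N} k) f z"

lemma pmm_energy_nonneg: "pmm_energy N k f z \<ge> 0"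
  unfolding pmm_energy_def by (rule exchange_energy_nonneg) simp

text \<open>
  A pair of neighbouring particles can travel through any environment, and exchange the two sites next to
  it, using only moves of rate at least 1. Up to the position of the pair this makes the
  environment an exclusion process to which the exchange gap applies.
\<close>

lemma paired_sq_dev:
  assumes "4 \<le> N"
  shows "\<exists>c. \<forall>u. 1 \<le> u \<longrightarrow> Suc u \<le> N \<longrightarrow>
    (\<Sum>\<eta> | \<eta> \<in> configs_on {1..N} (k + 2) \<and> \<eta> u = 1 \<and> \<eta> (Suc u) = 1. (f \<eta> - c)\<^sup>2)
      \<le> 64 * (real N)\<^sup>2 * (\<Sum>z = 1..<N. pmm_energy N (k + 2) f z)"
proof -
  define X where "X = configs_on {1..N} (k + 2)"
  define Y where "Y = configs_on {3..N} k"
  \<comment> \<open>\<open>v\<close> is the site just right of the pair at \<open>v - 2\<close> and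
    \<open>v - 1\<close>, so the pair assists the exchange of \<open>v\<close> and
    \<open>Suc v\<close>.\<close>
  define F where "F v \<omega> = f (insert_pair (v - 2) \<omega>)" for v \<omega>
  define r where "r z = sqrt (pmm_energy N (k + 2) f z)" for z
  define Q where "Q = (\<Sum>z = 1..<N. pmm_energy N (k + 2) f z)"
  define R where "R v = L2_set (\<lambda>\<omega>. F (Suc v) \<omega> - F v \<omega>) Y" for v
  define S where "S v = L2_set (\<lambda>\<omega>. F v (exchange v (Suc v) \<omega>) - F v \<omega>) Y" for v
  define \<rho> where "\<rho> = (\<Sum>z = 1..<N. r z)"
  have finX: "finite X" by (simp add: X_def finite_configs_on)
  have r0: "r z \<ge> 0" for z by (simp add: r_def pmm_energy_nonneg)
  have step: "L2_set (\<lambda>\<omega>. f (exchange z (Suc z) (p \<omega>)) - f (p \<omega>)) Y \<le> r z"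
    if "inj_on p Y" "p ` Y \<subseteq> X" "\<And>\<omega>. \<omega> \<in> Y \<Longrightarrow> pmm_rate z (Suc z) (p \<omega>) \<ge> 1" for z p
    unfolding r_def pmm_energy_def
    by (rule L2_set_exchange_le) (use that finX in \<open>auto simp: X_def\<close>)
  have bij: "bij_betw (insert_pair u) Y {\<eta> \<in> X. \<eta> u = 1 \<and> \<eta> (Suc u) = 1}"
    if "1 \<le> u" "Suc u \<le> N" for u
    using bij_betw_insert_pair[OF that] by (simp add: X_def Y_def)
  have R_le: "R v \<le> r (v - 1) + r (v - 2)" if v: "3 \<le> v" "v \<le> N" for v
  proof -
    define u where "u = v - 2"
    have u: "1 \<le> u" "u + 2 \<le> N" "v = u + 2" using v by (auto simp: u_def)
    define p where "p = (\<lambda>\<omega>. exchange (Suc u) (Suc (Suc u)) (insert_pair u \<omega>))"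
    have b: "inj_on (insert_pair u) Y" "insert_pair u ` Y \<subseteq> X"
      using bij[of u] u by (auto simp: bij_betw_def)
    have "inj_on p Y"
      using b(1) unfolding p_def inj_on_def by (metis exchange_exchange)
    moreover have "p ` Y \<subseteq> X"
      using b(2) u exchange_in[of "{1..N}" "Suc u" "Suc (Suc u)" _ "k + 2"] by (auto simp: p_def X_def)
    moreover have "pmm_rate u (Suc u) (p \<omega>) \<ge> 1" for \<omega>
      by (simp add: pmm_rate_def p_def exchange_apply insert_pair_def)
    ultimately have "L2_set (\<lambda>\<omega>. f (exchange u (Suc u) (p \<omega>)) - f (p \<omega>)) Y \<le> r u"
      by (rule step)
    moreover have "L2_set (\<lambda>\<omega>. f (p \<omega>) - f (insert_pair u \<omega>)) Y \<le> r (Suc u)"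
      unfolding p_def using b
      by (rule step) (simp add: pmm_rate_def insert_pair_def)
    moreover have "R v = L2_set (\<lambda>\<omega>. f (exchange u (Suc u) (p \<omega>)) - f (insert_pair u \<omega>)) Y"
      by (simp add: R_def F_def u(3) insert_pair_Suc p_def)
    ultimately show ?thesis
      using L2_set_diff_triangle[of "\<lambda>\<omega>. f (exchange u (Suc u) (p \<omega>))" "\<lambda>\<omega>. f (insert_pair u \<omega>)" Y
          "\<lambda>\<omega>. f (p \<omega>)"] u(3) by simp
  qed
  have S_le: "S v \<le> r v" if v: "3 \<le> v" "v < N" for v
  proof -
    define u where "u = v - 2"
    have u: "1 \<le> u" "u + 3 \<le> N" "v = u + 2" using v by (auto simp: u_def)
    have b: "inj_on (insert_pair u) Y" "insert_pair u ` Y \<subseteq> X"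
      using bij[of u] u by (auto simp: bij_betw_def)
    have "S v = L2_set (\<lambda>\<omega>. f (exchange v (Suc v) (insert_pair u \<omega>)) - f (insert_pair u \<omega>)) Y"
      using insert_pair_exchange[of u] by (simp add: S_def F_def u(3) numeral_3_eq_3)
    also have "\<dots> \<le> r v"
      using b by (rule step) (simp add: pmm_rate_def insert_pair_def u(3))
    finally show ?thesis .
  qed
  have R0: "R v \<ge> 0" and S0: "S v \<ge> 0" for v by (simp_all add: R_def S_def)
  \<comment> \<open>The range includes \<open>v = N\<close>, the last move of the pair, from
    \<open>N - 2\<close> to \<open>N - 1\<close>: the final bound concerns all pair
    positions.\<close>
  have "(\<Sum>v = 3..<Suc N. R v) \<le> (\<Sum>v = 3..<Suc N. r (v - 1)) + (\<Sum>v = 3..<Suc N. r (v - 2))"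
    unfolding sum.distrib[symmetric] by (intro sum_mono R_le) auto
  also have "(\<Sum>v = 3..<Suc N. r (v - 1)) = (\<Sum>z = 2..<N. r z)"
    by (rule sum.reindex_bij_witness[of _ "\<lambda>z. z + 1" "\<lambda>v. v - 1"]) auto
  also have "\<dots> \<le> \<rho>" unfolding \<rho>_def using r0 by (intro sum_mono2) auto
  also have "(\<Sum>v = 3..<Suc N. r (v - 2)) = (\<Sum>z = 1..<N - 1. r z)"
    by (rule sum.reindex_bij_witness[of _ "\<lambda>z. z + 2" "\<lambda>v. v - 2"]) auto
  also have "\<dots> \<le> \<rho>" unfolding \<rho>_def using r0 by (intro sum_mono2) auto
  finally have sumR: "(\<Sum>v = 3..<Suc N. R v) \<le> 2 * \<rho>" by simp
  have "(\<Sum>v = 3..<N. S v) \<le> (\<Sum>v = 3..<N. r v)" by (intro sum_mono S_le) auto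
  also have "\<dots> \<le> \<rho>" unfolding \<rho>_def using r0 by (intro sum_mono2) auto
  finally have sumS: "(\<Sum>v = 3..<N. S v) \<le> \<rho>" .
  have rho0: "\<rho> \<ge> 0" by (simp add: \<rho>_def sum_nonneg r0)
  have rho2: "\<rho>\<^sup>2 \<le> real N * Q"
  proof -
    have "\<rho>\<^sup>2 \<le> real (card {1..<N}) * Q"
      unfolding \<rho>_def r_def Q_def by (rule sum_sqrt_le) (simp_all add: pmm_energy_nonneg del: add_2_eq_Suc')
    also have "\<dots> \<le> real N * Q"
      by (intro mult_right_mono) (auto simp: Q_def intro!: sum_nonneg pmm_energy_nonneg)
    finally show ?thesis .
  qed
  have "sq_dev (F 3) Y \<le> 4 * real (Suc N - 3) * (3 * \<rho>)\<^sup>2"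
    unfolding Y_def
  proof (rule sq_dev_exchange_path)
    have "(\<Sum>v = 3..<N. R v) \<le> (\<Sum>v = 3..<Suc N. R v)"
      using R0 by (intro sum_mono2) auto
    then have "(\<Sum>v = 3..<N. R v) + (\<Sum>v = 3..<N. S v) \<le> 3 * \<rho>" using sumR sumS by simp
    then show "(\<Sum>v = 3..<N. L2_set (\<lambda>\<eta>. F (Suc v) \<eta> - F v \<eta>) (configs_on {3..N} k)) +
      (\<Sum>v = 3..<N. L2_set (\<lambda>\<eta>. F v (exchange v (Suc v) \<eta>) - F v \<eta>) (configs_on {3..N} k)) \<le> 3 * \<rho>"
      by (simp add: R_def S_def Y_def)
  qed (use assms in simp)
  also have "\<dots> \<le> 4 * real N * (3 * \<rho>)\<^sup>2"
    using assms by (intro mult_right_mono mult_left_mono) auto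
  finally have dev: "sq_dev (F 3) Y \<le> (6 * sqrt (real N) * \<rho>)\<^sup>2"
    by (simp add: power_mult_distrib)
  \<comment> \<open>The mean with the pair at sites 1 and 2 serves every \<open>u\<close>, since
    moving the pair from there to \<open>u\<close> adds at most \<open>2 * \<rho>\<close>.\<close>
  define c where "c = (\<Sum>\<xi>\<in>Y. F 3 \<xi>) / card Y"
  have mean: "L2_set (\<lambda>\<omega>. F 3 \<omega> - c) Y \<le> 6 * sqrt (real N) * \<rho>"
    using dev rho0 unfolding L2_set_def sq_dev_def c_def[symmetric] by (simp add: real_le_lsqrt)
  show ?thesis
  proof (intro exI[of _ c] allI impI)
    fix u assume u: "1 \<le> u" "Suc u \<le> N"
    have "(\<Sum>v = 3..<u + 2. R v) \<le> (\<Sum>v = 3..<Suc N. R v)"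
      using R0 u by (intro sum_mono2) auto
    then have "L2_set (\<lambda>\<omega>. F (u + 2) \<omega> - F 3 \<omega>) Y \<le> 2 * \<rho>"
      using L2_set_path[of 3 "u + 2" F Y] u sumR by (simp add: R_def)
    then have "L2_set (\<lambda>\<omega>. F (u + 2) \<omega> - c) Y \<le> 2 * \<rho> + 6 * sqrt (real N) * \<rho>"
      using L2_set_diff_triangle[of "F (u + 2)" "\<lambda>_. c" Y "F 3"] mean by simp
    also have "\<dots> \<le> 8 * sqrt (real N) * \<rho>"
    proof -
      have "1 * \<rho> \<le> sqrt (real N) * \<rho>" using assms rho0 by (intro mult_right_mono) auto
      then show ?thesis by (simp add: mult.commute)
    qed
    finally have "(L2_set (\<lambda>\<omega>. F (u + 2) \<omega> - c) Y)\<^sup>2 \<le> (8 * sqrt (real N) * \<rho>)\<^sup>2"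
      by (rule power_mono) simp
    also have "\<dots> = 64 * real N * \<rho>\<^sup>2" by (simp add: power_mult_distrib)
    \<comment> \<open>One factor \<open>N\<close> comes from the comparison with the complete graph,
      the other from Cauchy-Schwarz over the bonds.\<close>
    also have "\<dots> \<le> 64 * real N * (real N * Q)" using rho2 by (intro mult_left_mono) auto
    also have "\<dots> = 64 * (real N)\<^sup>2 * Q" by (simp add: power2_eq_square)
    finally have "(\<Sum>\<omega>\<in>Y. (f (insert_pair u \<omega>) - c)\<^sup>2) \<le> 64 * (real N)\<^sup>2 * Q"
      by (simp add: L2_set_power2 F_def)
    then show "(\<Sum>\<eta> | \<eta> \<in> configs_on {1..N} (k + 2) \<and> \<eta> u = 1 \<and> \<eta> (Suc u) = 1. (f \<eta> - c)\<^sup>2)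
      \<le> 64 * (real N)\<^sup>2 * (\<Sum>z = 1..<N. pmm_energy N (k + 2) f z)"
      using sum.reindex_bij_betw[OF bij[OF u], of "\<lambda>\<eta>. (f \<eta> - c)\<^sup>2"] by (simp add: Q_def X_def)
  qed
qed

section \<open>From arbitrary configurations to paired ones\<close>

text \<open>Energy of the symmetric simple exclusion process. In the Dirichlet form for
  \<open>\<theta> = 1\<close> it is weighted by \<open>1 / N\<close>.\<close>

definition ssep_energy :: "nat \<Rightarrow> nat \<Rightarrow> ((nat \<Rightarrow> nat) \<Rightarrow> real) \<Rightarrow> nat \<Rightarrow> real" where
  "ssep_energy N k f z = exchange_energy (\<lambda>_. 1) (configs_on {1..N} k) f z"

lemma ssep_energy_nonneg: "ssep_energy N k f z \<ge> 0"
  unfolding ssep_energy_def by (rule exchange_energy_nonneg) simp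

text \<open>Exchanging \<open>a + d\<close> with its right neighbour maps configurations with a
  partner at distance \<open>d + 1\<close> bijectively to those with one at distance
  \<open>d\<close>, whatever the site \<open>a + d\<close> contains. Each unit of distance thus
  costs one exclusion bond.\<close>

lemma L2_set_approach:
  fixes N k a d :: nat and c :: real
  defines "B \<equiv> \<lambda>d. {\<eta> \<in> configs_on {1..N} k. \<eta> a = 1 \<and> \<eta> (a + d) = 1}"
  assumes a: "1 \<le> a" and "1 \<le> d" "a + d \<le> N"
  shows "L2_set (\<lambda>\<eta>. f \<eta> - c) (B d)
    \<le> L2_set (\<lambda>\<eta>. f \<eta> - c) (B 1) + (\<Sum>z = a + 1..<a + d. sqrt (ssep_energy N k f z))"
  using assms(3,4)
proof (induction d rule: dec_induct)
  case base
  show ?case by simp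
next
  case (step d)
  define t where "t = exchange (a + d) (Suc (a + d))"
  have in_t: "t \<eta> \<in> configs_on {1..N} k" if "\<eta> \<in> configs_on {1..N} k" for \<eta>
    using that step.prems a by (simp add: t_def exchange_in)
  have "t ` B (Suc d) \<subseteq> B d" "t ` B d \<subseteq> B (Suc d)"
    using in_t step.hyps by (auto simp: B_def t_def exchange_apply)
  then have bij: "bij_betw t (B (Suc d)) (B d)"
    unfolding t_def by (rule bij_betw_exchange)
  have "L2_set (\<lambda>\<eta>. f (t \<eta>) - f \<eta>) (B (Suc d)) \<le> sqrt (ssep_energy N k f (a + d))"
    unfolding t_def ssep_energy_def
    using L2_set_exchange_le[of "configs_on {1..N} k" "\<lambda>x. x" "B (Suc d)" "\<lambda>_. 1" f "a + d"]
    by (auto simp: B_def finite_configs_on)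
  moreover have "L2_set (\<lambda>\<eta>. f (t \<eta>) - c) (B (Suc d)) = L2_set (\<lambda>\<eta>. f \<eta> - c) (B d)"
    using L2_set_reindex[OF bij, of "\<lambda>\<eta>. f \<eta> - c"] .
  moreover have "L2_set (\<lambda>\<eta>. f \<eta> - c) (B d)
    \<le> L2_set (\<lambda>\<eta>. f \<eta> - c) (B 1) + (\<Sum>z = a + 1..<a + d. sqrt (ssep_energy N k f z))"
    using step by simp
  moreover have "(\<Sum>z = a + 1..<a + Suc d. sqrt (ssep_energy N k f z))
      = (\<Sum>z = a + 1..<a + d. sqrt (ssep_energy N k f z)) + sqrt (ssep_energy N k f (a + d))"
    using step.hyps by simp
  ultimately show ?case
    using L2_set_diff_triangle[of f "\<lambda>_. c" "B (Suc d)" "\<lambda>\<eta>. f (t \<eta>)"]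
      L2_set_diff_commute[of f "\<lambda>\<eta>. f (t \<eta>)" "B (Suc d)"] by linarith
qed

text \<open>
  Particles without another particle at distance at most \<open>L\<close> to their right lie in different blocks
  of length \<open>L\<close>.
\<close>

lemma card_close_pairs:
  assumes \<eta>: "\<eta> \<in> configs_on {1..N} k" and L: "0 < L"
  shows "k \<le> card {(a, d). a \<in> {1..N} \<and> d \<in> {1..L} \<and> a + d \<le> N \<and> \<eta> a = 1 \<and> \<eta> (a + d) = 1}
    + (N div L + 1)"
proof -
  define P where
    "P = {(a, d). a \<in> {1..N} \<and> d \<in> {1..L} \<and> a + d \<le> N \<and> \<eta> a = 1 \<and> \<eta> (a + d) = 1}"
  define S where "S = {x \<in> {1..N}. \<eta> x = 1}"
  define bad where "bad = S - fst ` P"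
  have finP: "finite P"
    by (rule finite_subset[of _ "{1..N} \<times> {1..L}"]) (auto simp: P_def)
  have "k = (\<Sum>x\<in>{1..N}. \<eta> x)" using \<eta> by (simp add: configs_on_def)
  also have "\<dots> = (\<Sum>x\<in>{1..N}. if \<eta> x = 1 then 1 else 0)"
    using configs_on_01[OF \<eta>] by (intro sum.cong) auto
  also have "\<dots> = card S" by (simp add: S_def sum.If_cases Int_def)
  finally have k: "k = card S" .
  have no: "False" if x: "x \<in> bad" and y: "y \<in> bad" and "x < y" "x div L = y div L" for x y
  proof -
    have "y < x + L"
    proof -
      have "y = y div L * L + y mod L" "x div L * L \<le> x" by simp_all
      then show ?thesis
        unfolding \<open>x div L = y div L\<close> using mod_less_divisor[OF L, of y] by linarith
    qed
    then have "(x, y - x) \<in> P" using x y \<open>x < y\<close> by (auto simp: P_def bad_def S_def)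
    then have "x \<in> fst ` P" by force
    then show False using x by (simp add: bad_def)
  qed
  have "inj_on (\<lambda>x. x div L) bad"
    by (rule inj_onI) (metis no nat_neq_iff)
  \<comment> \<open>Block numbers run from 0 to \<open>N div L\<close>, hence the \<open>+ 1\<close>
    in the bound.\<close>
  moreover have "(\<lambda>x. x div L) ` bad \<subseteq> {..N div L}"
    by (auto simp: bad_def S_def intro: div_le_mono)
  ultimately have "card bad \<le> card {..N div L}" by (rule card_inj_on_le) simp
  moreover have "card S \<le> card bad + card (fst ` P)"
    using card_Un_le[of bad "fst ` P"] card_mono[of "bad \<union> fst ` P" S] finP
    by (force simp: bad_def S_def)
  moreover have "card (fst ` P) \<le> card P" using finP by (rule card_image_le)
  ultimately show ?thesis using k by (simp add: P_def)
qed

text \<open>Double counting of close pairs \<open>(a, d)\<close>: each configuration has at least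
  \<open>k / 4\<close> of them, and there are at most \<open>N * L\<close> sets
  \<open>B a d\<close>. With \<open>L \<le> 5 * N / k\<close> the prefactor
  \<open>4 * N * L / k\<close> is at most \<open>20 * N^2 / k^2\<close>.\<close>

lemma sq_dev_le_pairs:
  assumes N: "4 \<le> N" and k: "2 \<le> k" "k \<le> N"
  shows "sq_dev f (configs_on {1..N} k) \<le> 20 * (real N)\<^sup>2 / (real k)\<^sup>2 *
    (128 * (real N)\<^sup>2 * (\<Sum>z = 1..<N. pmm_energy N k f z)
      + 10 * real N / real k * (\<Sum>z = 1..<N. ssep_energy N k f z))"
proof -
  define X where "X = configs_on {1..N} k"
  \<comment> \<open>\<open>L\<close> exceeds \<open>4 * N / k\<close>, so at most
    \<open>k / 4 + 1\<close> particles lack a close partner.\<close>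
  define L where "L = 4 * N div k + 1"
  define Qp where "Qp = (\<Sum>z = 1..<N. pmm_energy N k f z)"
  define Qs where "Qs = (\<Sum>z = 1..<N. ssep_energy N k f z)"
  define P where "P = {(a, d). a \<in> {1..N} \<and> d \<in> {1..L} \<and> a + d \<le> N}"
  define B where "B a d = {\<eta> \<in> X. \<eta> a = 1 \<and> \<eta> (a + d) = 1}" for a d
  have finX: "finite X" by (simp add: X_def finite_configs_on)
  have P_sub: "P \<subseteq> {1..N} \<times> {1..L}" by (auto simp: P_def)
  then have finP: "finite P" by (rule finite_subset) simp
  have "card P \<le> card ({1..N} \<times> {1..L})" using P_sub by (intro card_mono) auto
  then have cardP: "card P \<le> N * L" by simp
  have Q0: "Qp \<ge> 0" "Qs \<ge> 0"
    by (simp_all add: Qp_def Qs_def sum_nonneg pmm_energy_nonneg ssep_energy_nonneg)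
  have kpos: "real k > 0" using k by simp
  have L_le: "real L \<le> 5 * real N / real k"
  proof -
    have "real (4 * N div k) \<le> real (4 * N) / real k" by (rule of_nat_div_le_of_nat)
    moreover have "1 \<le> real N / real k" using k by simp
    ultimately show ?thesis by (simp add: L_def)
  qed
  obtain j where j: "k = j + 2" using k(1) by (metis add.commute le_Suc_ex)
  obtain c where c: "\<And>u. 1 \<le> u \<Longrightarrow> Suc u \<le> N \<Longrightarrow>
    (\<Sum>\<eta> | \<eta> \<in> X \<and> \<eta> u = 1 \<and> \<eta> (Suc u) = 1. (f \<eta> - c)\<^sup>2) \<le> 64 * (real N)\<^sup>2 * Qp"
    using paired_sq_dev[OF N, where k = j and f = f] unfolding X_def Qp_def j by blast
  \<comment> \<open>The two particles are brought together before the estimate for neighbouring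
    pairs is used; squaring the sum of the two costs doubles 64 to 128.\<close>
  have B_le: "(\<Sum>\<eta>\<in>B a d. (f \<eta> - c)\<^sup>2) \<le> 128 * (real N)\<^sup>2 * Qp + 2 * real L * Qs"
    if ad: "(a, d) \<in> P" for a d
  proof -
    define s where "s = (\<Sum>z = a + 1..<a + d. sqrt (ssep_energy N k f z))"
    have "L2_set (\<lambda>\<eta>. f \<eta> - c) (B a d) \<le> L2_set (\<lambda>\<eta>. f \<eta> - c) (B a 1) + s"
      using L2_set_approach[of a d N f c k] ad by (auto simp: P_def B_def X_def s_def)
    then have "(L2_set (\<lambda>\<eta>. f \<eta> - c) (B a d))\<^sup>2 \<le> (L2_set (\<lambda>\<eta>. f \<eta> - c) (B a 1) + s)\<^sup>2"
      by (rule power_mono) simp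
    also have "\<dots> \<le> 2 * (L2_set (\<lambda>\<eta>. f \<eta> - c) (B a 1))\<^sup>2 + 2 * s\<^sup>2"
      using sum_squares_bound[of "L2_set (\<lambda>\<eta>. f \<eta> - c) (B a 1)" s] by (simp add: power2_sum)
    also have "(L2_set (\<lambda>\<eta>. f \<eta> - c) (B a 1))\<^sup>2 \<le> 64 * (real N)\<^sup>2 * Qp"
      using c[of a] ad by (auto simp: L2_set_power2 B_def P_def)
    also have "s\<^sup>2 \<le> real (card {a + 1..<a + d}) * (\<Sum>z = a + 1..<a + d. ssep_energy N k f z)"
      unfolding s_def by (rule sum_sqrt_le) (auto simp: ssep_energy_nonneg)
    also have "\<dots> \<le> real L * Qs"
      unfolding Qs_def using ad
      by (intro mult_mono sum_mono2) (auto simp: P_def ssep_energy_nonneg intro: sum_nonneg)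
    finally show ?thesis by (simp add: L2_set_power2)
  qed
  have W: "real k / 4 \<le> real (card {p \<in> P. \<eta> \<in> B (fst p) (snd p)})" if \<eta>: "\<eta> \<in> X" for \<eta>
  proof -
    have "{p \<in> P. \<eta> \<in> B (fst p) (snd p)}
        = {(a, d). a \<in> {1..N} \<and> d \<in> {1..L} \<and> a + d \<le> N \<and> \<eta> a = 1 \<and> \<eta> (a + d) = 1}"
      using \<eta> by (auto simp: P_def B_def)
    then have "k \<le> card {p \<in> P. \<eta> \<in> B (fst p) (snd p)} + (N div L + 1)"
      using card_close_pairs[of \<eta> N k L] \<eta> by (simp add: X_def L_def)
    then have "real k \<le> real (card {p \<in> P. \<eta> \<in> B (fst p) (snd p)}) + (real (N div L) + 1)"
      by (metis of_nat_1 of_nat_add of_nat_mono)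
    moreover have "real (N div L) \<le> real k / 4"
    proof -
      have "4 * N < k * L"
        using dividend_less_div_times[of k "4 * N"] k by (simp add: L_def algebra_simps)
      then have "4 * real N \<le> real k * real L"
        by (metis less_imp_le of_nat_mono of_nat_mult of_nat_numeral)
      then have "real N / real L \<le> real k / 4" by (simp add: L_def field_simps)
      then show ?thesis using of_nat_div_le_of_nat[of N L, where 'a = real] by linarith
    qed
    \<comment> \<open>This is \<open>k - k / 4 - 1 \<ge> k / 4\<close>, which holds from
      \<open>k = 2\<close> on.\<close>
    ultimately show ?thesis using k(1) by simp
  qed
  have "real k / 4 * (\<Sum>\<eta>\<in>X. (f \<eta> - c)\<^sup>2) = (\<Sum>\<eta>\<in>X. real k / 4 * (f \<eta> - c)\<^sup>2)"
    by (simp add: sum_distrib_left)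
  also have "\<dots> \<le> (\<Sum>\<eta>\<in>X. real (card {p \<in> P. \<eta> \<in> B (fst p) (snd p)}) * (f \<eta> - c)\<^sup>2)"
    by (intro sum_mono mult_right_mono W) auto
  also have "\<dots> = (\<Sum>\<eta>\<in>X. \<Sum>p\<in>P. if \<eta> \<in> B (fst p) (snd p) then (f \<eta> - c)\<^sup>2 else 0)"
    using finP by (intro sum.cong refl) (simp add: sum.If_cases Int_def)
  also have "\<dots> = (\<Sum>p\<in>P. \<Sum>\<eta>\<in>X. if \<eta> \<in> B (fst p) (snd p) then (f \<eta> - c)\<^sup>2 else 0)"
    by (rule sum.swap)
  also have "\<dots> = (\<Sum>p\<in>P. \<Sum>\<eta>\<in>B (fst p) (snd p). (f \<eta> - c)\<^sup>2)"
    using finX by (intro sum.cong[OF refl] sum.mono_neutral_cong_right) (auto simp: B_def)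
  also have "\<dots> \<le> (\<Sum>p\<in>P. 128 * (real N)\<^sup>2 * Qp + 2 * real L * Qs)"
    by (intro sum_mono B_le) simp
  also have "\<dots> = real (card P) * (128 * (real N)\<^sup>2 * Qp + 2 * real L * Qs)" by simp
  also have "\<dots> \<le> (real N * (5 * real N / real k)) *
      (128 * (real N)\<^sup>2 * Qp + 2 * (5 * real N / real k) * Qs)"
  proof (intro mult_mono add_mono order_refl)
    have "real (card P) \<le> real N * real L" using cardP by (metis of_nat_mono of_nat_mult)
    also have "\<dots> \<le> real N * (5 * real N / real k)" using L_le by (intro mult_left_mono) auto
    finally show "real (card P) \<le> real N * (5 * real N / real k)" .
  qed (use Q0 L_le in auto)
  finally have "(\<Sum>\<eta>\<in>X. (f \<eta> - c)\<^sup>2) \<le> 20 * (real N)\<^sup>2 / (real k)\<^sup>2 *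
    (128 * (real N)\<^sup>2 * Qp + 10 * real N / real k * Qs)"
    using kpos by (simp add: field_simps power2_eq_square)
  then show ?thesis
    using sq_dev_le[OF finX, of f c] unfolding X_def Qp_def Qs_def by linarith
qed

text \<open>Exclusion jumps need no device, so the family \<open>F\<close> is constant and moving
  the device costs nothing. This serves for \<open>k = 1\<close>, where no pair exists.\<close>

lemma sq_dev_le_ssep:
  assumes "1 \<le> N"
  shows "sq_dev f (configs_on {1..N} k)
    \<le> 4 * (real N)\<^sup>2 * (\<Sum>z = 1..<N. ssep_energy N k f z)"
proof -
  define Z where "Z = (\<Sum>z = 1..<N. sqrt (ssep_energy N k f z))"
  have "sq_dev f (configs_on {1..N} k) \<le> 4 * real (Suc N - 1) * Z\<^sup>2"
  proof (rule sq_dev_exchange_path[of 1 N "\<lambda>_. f", OF assms])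
    have "(\<Sum>v = 1..<N. L2_set (\<lambda>\<eta>. f (exchange v (Suc v) \<eta>) - f \<eta>) (configs_on {1..N} k)) \<le> Z"
      unfolding Z_def ssep_energy_def
      using L2_set_exchange_le[of "configs_on {1..N} k" "\<lambda>x. x" "configs_on {1..N} k" "\<lambda>_. 1" f]
      by (intro sum_mono) (auto simp: finite_configs_on)
    then show "(\<Sum>v = 1..<N. L2_set (\<lambda>\<eta>. f \<eta> - f \<eta>) (configs_on {1..N} k)) +
      (\<Sum>v = 1..<N. L2_set (\<lambda>\<eta>. f (exchange v (Suc v) \<eta>) - f \<eta>) (configs_on {1..N} k)) \<le> Z"
      by (simp add: L2_set_def)
  qed
  also have "\<dots> \<le> 4 * real N * (real N * (\<Sum>z = 1..<N. ssep_energy N k f z))"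
  proof (intro mult_mono order_refl)
    have "Z\<^sup>2 \<le> real (card {1..<N}) * (\<Sum>z = 1..<N. ssep_energy N k f z)"
      unfolding Z_def by (rule sum_sqrt_le) (auto simp: ssep_energy_nonneg)
    also have "\<dots> \<le> real N * (\<Sum>z = 1..<N. ssep_energy N k f z)"
      by (intro mult_right_mono sum_nonneg ssep_energy_nonneg) auto
    finally show "Z\<^sup>2 \<le> real N * (\<Sum>z = 1..<N. ssep_energy N k f z)" .
  qed auto
  finally show ?thesis by (simp add: power2_eq_square mult_ac)
qed

section \<open>The Dirichlet form\<close>

lemma generator_eq:
  assumes \<eta>: "\<eta> \<in> configs_on {1..N} k" and N: "1 \<le> N"
  shows "generator 1 N f \<eta> =
    (\<Sum>z = 1..<N. (real (pmm_rate z (Suc z) \<eta>) + 1 / real N) * (f (exchange z (Suc z) \<eta>) - f \<eta>))"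
proof -
  define g where "g = (\<lambda>(x, y). (real (pmm_rate x y \<eta>) + real N powr (1 - 2)) *
        real (\<eta> x) * (1 - real (\<eta> y)) * (f (exchange x y \<eta>) - f \<eta>))"
  have pw: "real N powr (1 - 2) = 1 / real N"
    using N by (simp add: powr_minus_divide)
  have "{(x, y). x \<in> sites N \<and> y \<in> sites N \<and> \<bar>int x - int y\<bar> = 1}
      = (\<lambda>z. (z, Suc z)) ` {1..<N} \<union> (\<lambda>z. (Suc z, z)) ` {1..<N}" (is "?E = ?R \<union> ?L")
  proof (intro equalityI subsetI)
    fix p assume "p \<in> ?E"
    then obtain x y where p: "p = (x, y)" "1 \<le> x" "x \<le> N" "1 \<le> y" "y \<le> N" "\<bar>int x - int y\<bar> = 1"
      by (auto simp: sites_def)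
    then consider "y = Suc x" | "x = Suc y" by linarith
    then show "p \<in> ?R \<union> ?L" using p by cases auto
  qed (auto simp: sites_def)
  then have "generator 1 N f \<eta> = (\<Sum>p\<in>?R \<union> ?L. g p)"
    unfolding generator_def g_def by simp
  also have "\<dots> = (\<Sum>p\<in>?R. g p) + (\<Sum>p\<in>?L. g p)"
    by (rule sum.union_disjoint) auto
  also have "\<dots> = (\<Sum>z = 1..<N. g (z, Suc z) + g (Suc z, z))"
    by (simp add: sum.reindex inj_on_def sum.distrib)
  also have "\<dots> = (\<Sum>z = 1..<N. (real (pmm_rate z (Suc z) \<eta>) + 1 / real N)
      * (f (exchange z (Suc z) \<eta>) - f \<eta>))"
  proof (rule sum.cong[OF refl])
    fix z
    have r: "pmm_rate (Suc z) z \<eta> = pmm_rate z (Suc z) \<eta>" by (simp add: pmm_rate_def)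
    show "g (z, Suc z) + g (Suc z, z)
        = (real (pmm_rate z (Suc z) \<eta>) + 1 / real N) * (f (exchange z (Suc z) \<eta>) - f \<eta>)"
    proof (cases "\<eta> z = \<eta> (Suc z)")
      case True
      then have "exchange z (Suc z) \<eta> = \<eta>" by (auto simp: exchange_apply fun_eq_iff)
      then show ?thesis by (simp add: g_def exchange_commute[of "Suc z" z])
    next
      case False
      then have "\<eta> z = 1 \<and> \<eta> (Suc z) = 0 \<or> \<eta> z = 0 \<and> \<eta> (Suc z) = 1"
        using configs_on_01[OF \<eta>, of z] configs_on_01[OF \<eta>, of "Suc z"] by auto
      then show ?thesis by (auto simp: g_def exchange_commute[of "Suc z" z] r pw)
    qed
  qed
  finally show ?thesis .
qed

text \<open>Substituting the exchange in the sum and averaging both forms symmetrises the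
  expression, because \<open>c\<close> is invariant.\<close>

lemma exchange_reversible:
  fixes c :: "(nat \<Rightarrow> nat) \<Rightarrow> real"
  assumes bij: "bij_betw (exchange x y) X X" and c: "\<And>\<eta>. c (exchange x y \<eta>) = c \<eta>"
  shows "(\<Sum>\<eta>\<in>X. - f \<eta> * (c \<eta> * (f (exchange x y \<eta>) - f \<eta>)))
    = (\<Sum>\<eta>\<in>X. c \<eta> * (f (exchange x y \<eta>) - f \<eta>)\<^sup>2) / 2"
proof -
  have "(\<Sum>\<eta>\<in>X. - f \<eta> * (c \<eta> * (f (exchange x y \<eta>) - f \<eta>)))
      = (\<Sum>\<eta>\<in>X. - f (exchange x y \<eta>) * (c \<eta> * (f \<eta> - f (exchange x y \<eta>))))"
    using sum.reindex_bij_betw[OF bij, of "\<lambda>\<eta>. - f \<eta> * (c \<eta> * (f (exchange x y \<eta>) - f \<eta>))"]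
    by (simp add: c)
  moreover have "(\<Sum>\<eta>\<in>X. - f \<eta> * (c \<eta> * (f (exchange x y \<eta>) - f \<eta>)))
      + (\<Sum>\<eta>\<in>X. - f (exchange x y \<eta>) * (c \<eta> * (f \<eta> - f (exchange x y \<eta>))))
      = (\<Sum>\<eta>\<in>X. c \<eta> * (f (exchange x y \<eta>) - f \<eta>)\<^sup>2)"
    unfolding sum.distrib[symmetric] by (intro sum.cong refl) (simp add: power2_eq_square algebra_simps)
  ultimately show ?thesis by simp
qed

lemma expectation_canonical:
  assumes "k \<le> N"
  shows "measure_pmf.expectation (canonical N k) g
    = (\<Sum>\<eta>\<in>configs_on {1..N} k. g \<eta>) / real (N choose k)"
proof -
  have c: "finite (configs_on {1..N} k)" "card (configs_on {1..N} k) = N choose k"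
    using card_configs_on[of "{1..N}" k] by auto
  then have "configs_on {1..N} k \<noteq> {}" using assms zero_less_binomial[of k N] by force
  then show ?thesis
    using c by (simp add: canonical_def hyperplane_eq integral_pmf_of_set)
qed

lemma dirichlet_form_eq:
  assumes "k \<le> N" "1 \<le> N"
  shows "dirichlet_form (generator 1 N) (canonical N k) f =
    ((\<Sum>z = 1..<N. pmm_energy N k f z) + (\<Sum>z = 1..<N. ssep_energy N k f z) / real N)
      / 2 / real (N choose k)"
proof -
  define X where "X = configs_on {1..N} k"
  define w where "w z \<eta> = real (pmm_rate z (Suc z) \<eta>) + 1 / real N" for z \<eta>
  have "(\<Sum>\<eta>\<in>X. - f \<eta> * generator 1 N f \<eta>)
      = (\<Sum>\<eta>\<in>X. \<Sum>z = 1..<N. - f \<eta> * (w z \<eta> * (f (exchange z (Suc z) \<eta>) - f \<eta>)))"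
    using generator_eq[of _ N k f] assms
    by (intro sum.cong[OF refl]) (simp add: X_def w_def sum_distrib_left sum_negf)
  also have "\<dots> = (\<Sum>z = 1..<N. \<Sum>\<eta>\<in>X. - f \<eta> * (w z \<eta> * (f (exchange z (Suc z) \<eta>) - f \<eta>)))"
    by (rule sum.swap)
  also have "\<dots> = (\<Sum>z = 1..<N. (pmm_energy N k f z + ssep_energy N k f z / real N) / 2)"
  proof (rule sum.cong[OF refl])
    fix z assume z: "z \<in> {1..<N}"
    have "exchange z (Suc z) ` X \<subseteq> X"
      using exchange_in[of "{1..N}" z "Suc z"] z by (auto simp: X_def)
    then have "bij_betw (exchange z (Suc z)) X X" using bij_betw_exchange by blast
    \<comment> \<open>As \<open>z \<ge> 1\<close>, the subtraction does not truncate; the rate reads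
      only sites off the bond and is unchanged by the exchange.\<close>
    moreover have "z - 1 \<noteq> z" "z - 1 \<noteq> Suc z" using z by auto
    then have "w z (exchange z (Suc z) \<eta>) = w z \<eta>" for \<eta>
      by (simp add: w_def pmm_rate_def exchange_apply)
    ultimately have "(\<Sum>\<eta>\<in>X. - f \<eta> * (w z \<eta> * (f (exchange z (Suc z) \<eta>) - f \<eta>)))
        = (\<Sum>\<eta>\<in>X. w z \<eta> * (f (exchange z (Suc z) \<eta>) - f \<eta>)\<^sup>2) / 2"
      by (rule exchange_reversible)
    also have "(\<Sum>\<eta>\<in>X. w z \<eta> * (f (exchange z (Suc z) \<eta>) - f \<eta>)\<^sup>2)
        = pmm_energy N k f z + ssep_energy N k f z / real N"
      by (simp add: w_def pmm_energy_def ssep_energy_def exchange_energy_def X_def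
          sum_divide_distrib sum.distrib[symmetric] distrib_right)
    finally show "(\<Sum>\<eta>\<in>X. - f \<eta> * (w z \<eta> * (f (exchange z (Suc z) \<eta>) - f \<eta>)))
        = (pmm_energy N k f z + ssep_energy N k f z / real N) / 2" .
  qed
  also have "\<dots> = ((\<Sum>z = 1..<N. pmm_energy N k f z) + (\<Sum>z = 1..<N. ssep_energy N k f z) / real N) / 2"
    by (simp add: sum_divide_distrib sum.distrib add_divide_distrib)
  finally show ?thesis
    unfolding dirichlet_form_def expectation_canonical[OF assms(1)] X_def[symmetric] by (simp only:)
qed

section \<open>The variance and the final comparison\<close>

lemma variance_eq:
  assumes "k \<le> N"
  shows "measure_pmf.variance (canonical N k) f = sq_dev f (configs_on {1..N} k) / real (N choose k)"
  using card_configs_on[of "{1..N}" k] assms by (simp add: expectation_canonical sq_dev_def)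

text \<open>A lower bound on the infimum over the reals requires that some test function exists. At
  least two configurations are present, and the indicator of one of them is not constant.\<close>

lemma variance_nonzero:
  assumes "1 \<le> k" "k < N"
  shows "\<exists>f :: _ \<Rightarrow> real. measure_pmf.variance (canonical N k) f \<noteq> 0"
proof -
  define X where "X = configs_on {1..N} k"
  obtain n j where nj: "N = Suc n" "k = Suc j" using assms by (cases N; cases k) auto
  have fin: "finite X" and card: "card X = N choose k"
    using card_configs_on[of "{1..N}" k] by (auto simp: X_def)
  have "n choose j > 0" "n choose Suc j > 0" using assms nj by (simp_all add: zero_less_binomial)
  moreover have "card X = (n choose j) + (n choose Suc j)" using card nj by simp
  ultimately have c: "real (card X) \<ge> 2" by linarith
  then obtain \<xi> where \<xi>: "\<xi> \<in> X" by fastforce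
  define f where "f = (\<lambda>\<eta>. if \<eta> = \<xi> then 1 else 0 :: real)"
  have "(\<Sum>\<eta>\<in>X. f \<eta>) = 1" using fin \<xi> by (simp add: f_def)
  then have "(f \<xi> - 1 / card X)\<^sup>2 \<le> sq_dev f X"
    unfolding sq_dev_def using fin \<xi>
      member_le_sum[of \<xi> X "\<lambda>\<eta>. (f \<eta> - 1 / card X)\<^sup>2"] by simp
  moreover have "(f \<xi> - 1 / card X)\<^sup>2 > 0" using c by (simp add: f_def)
  ultimately have "sq_dev f X > 0" by linarith
  moreover have "real (N choose k) > 0" using assms by simp
  ultimately have "measure_pmf.variance (canonical N k) f \<noteq> 0"
    using variance_eq[of k N f] assms by (simp add: X_def)
  then show ?thesis by (rule exI[of _ f])
qed

text \<open>A single particle is handled by exclusion alone, at order \<open>N^3\<close>; for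
  \<open>k \<ge> 2\<close> the pair estimate applies, and
  \<open>2760 = 20 * (128 + 10)\<close>.\<close>

lemma sq_dev_le_energy:
  assumes k: "1 \<le> k" "3 * k \<le> N"
  shows "sq_dev f (configs_on {1..N} k) \<le> 2760 * (real N ^ 4 / (real k)\<^sup>2) *
    ((\<Sum>z = 1..<N. pmm_energy N k f z) + (\<Sum>z = 1..<N. ssep_energy N k f z) / real N)"
proof -
  define Qp where "Qp = (\<Sum>z = 1..<N. pmm_energy N k f z)"
  define Qs where "Qs = (\<Sum>z = 1..<N. ssep_energy N k f z)"
  define n where "n = real N"
  have n: "n \<ge> 3" using k by (simp add: n_def)
  have Q0: "Qp \<ge> 0" "Qs \<ge> 0"
    by (simp_all add: Qp_def Qs_def sum_nonneg pmm_energy_nonneg ssep_energy_nonneg)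
  have "sq_dev f (configs_on {1..N} k) \<le> 2760 * (n ^ 4 / (real k)\<^sup>2) * (Qp + Qs / n)"
  proof (cases "k = 1")
    case True
    have "sq_dev f (configs_on {1..N} k) \<le> 4 * n\<^sup>2 * Qs"
      using sq_dev_le_ssep[of N f k] k by (simp add: n_def Qs_def)
    also have "\<dots> = 4 * n ^ 3 * (Qs / n)"
      using n by (simp add: power2_eq_square power3_eq_cube)
    also have "\<dots> \<le> (2760 * n ^ 4) * (Qp + Qs / n)"
    proof (rule mult_mono)
      have "n ^ 3 \<le> n ^ 4" using n by (intro power_increasing) auto
      moreover have "0 \<le> n ^ 3" using n by simp
      ultimately show "4 * n ^ 3 \<le> 2760 * n ^ 4" by linarith
    qed (use n Q0 in auto)
    finally show ?thesis using True by simp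
  next
    case False
    have "sq_dev f (configs_on {1..N} k)
        \<le> 20 * n\<^sup>2 / (real k)\<^sup>2 * (128 * n\<^sup>2 * Qp + 10 * n / real k * Qs)"
      using sq_dev_le_pairs[of N k f] k False by (simp add: n_def Qp_def Qs_def)
    also have "\<dots> \<le> 20 * n\<^sup>2 / (real k)\<^sup>2 * (138 * n\<^sup>2 * (Qp + Qs / n))"
    proof (rule mult_left_mono)
      have "10 * n / real k * Qs \<le> 10 * n * Qs"
        using k n Q0 by (intro mult_right_mono) (auto simp: field_simps)
      \<comment> \<open>The exclusion part has weight \<open>1 / n\<close>; restoring it costs a
        factor \<open>n\<close>, so both parts are of order \<open>n^2\<close>.\<close>
      moreover have "n * Qs = n\<^sup>2 * (Qs / n)" using n by (simp add: power2_eq_square)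
      moreover have "0 \<le> n\<^sup>2 * Qp" "0 \<le> n\<^sup>2 * (Qs / n)" using n Q0 by auto
      ultimately show "128 * n\<^sup>2 * Qp + 10 * n / real k * Qs \<le> 138 * n\<^sup>2 * (Qp + Qs / n)"
        using distrib_left[of "138 * n\<^sup>2" Qp "Qs / n"] by linarith
    qed simp
    also have "\<dots> = 2760 * (n ^ 4 / (real k)\<^sup>2) * (Qp + Qs / n)"
      by (simp add: power2_eq_square power4_eq_xxxx)
    finally show ?thesis .
  qed
  then show ?thesis by (simp add: n_def Qp_def Qs_def)
qed

theorem proposition2p5:
  fixes \<theta> :: real
  assumes "\<theta> = 1"
  shows "\<exists>C::real. C > 0 \<and>
           (\<forall>(N::nat) (k::nat) (\<rho>::real).
              N \<ge> 1 \<longrightarrow> 1 \<le> k \<longrightarrow> real k \<le> real N / 3 \<longrightarrow> \<rho> = real k / real N \<longrightarrow>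
              spectral_gap (generator \<theta> N) (canonical N k) \<ge> C * (\<rho>\<^sup>2 / (real N)\<^sup>2))"
proof (intro exI[of _ "1 / 5520"] conjI allI impI)
  fix N k :: nat and \<rho> :: real
  assume N: "N \<ge> 1" and k: "1 \<le> k" and kN: "real k \<le> real N / 3" and \<rho>: "\<rho> = real k / real N"
  have k3: "3 * k \<le> N" using kN by linarith
  then have k': "k \<le> N" "k < N" using k by auto
  define M where "M = real (N choose k)"
  have M: "M > 0" using k' by (simp add: M_def)
  show "1 / 5520 * (\<rho>\<^sup>2 / (real N)\<^sup>2) \<le> spectral_gap (generator \<theta> N) (canonical N k)"
    unfolding spectral_gap_def assms
  proof (rule cINF_greatest)
    show "{f :: _ \<Rightarrow> real. measure_pmf.variance (canonical N k) f \<noteq> 0} \<noteq> {}"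
      using variance_nonzero[OF k k'(2)] by simp
  next
    fix f :: "(nat \<Rightarrow> nat) \<Rightarrow> real" assume "f \<in> {f. measure_pmf.variance (canonical N k) f \<noteq> 0}"
    then have nz: "sq_dev f (configs_on {1..N} k) \<noteq> 0"
      using variance_eq[OF k'(1), of f] by auto
    define V where "V = sq_dev f (configs_on {1..N} k)"
    define E where
      "E = (\<Sum>z = 1..<N. pmm_energy N k f z) + (\<Sum>z = 1..<N. ssep_energy N k f z) / real N"
    have "V \<ge> 0" by (simp add: V_def sq_dev_def sum_nonneg)
    then have V: "V > 0" using nz by (simp add: V_def)
    have "V \<le> 2760 * (real N ^ 4 / (real k)\<^sup>2) * E"
      unfolding V_def E_def using k k3 by (rule sq_dev_le_energy)
    moreover have "real N ^ 4 > 0" "(real k)\<^sup>2 > 0" using N k by auto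
    \<comment> \<open>The factor \<open>1 / 2\<close> in the Dirichlet form turns 2760 into
      5520.\<close>
    ultimately have "(real k)\<^sup>2 / (5520 * real N ^ 4) \<le> E / 2 / V"
      using V by (simp add: field_simps)
    moreover have "1 / 5520 * (\<rho>\<^sup>2 / (real N)\<^sup>2) = (real k)\<^sup>2 / (5520 * real N ^ 4)"
      by (simp add: \<rho> power2_eq_square power4_eq_xxxx)
    ultimately have "1 / 5520 * (\<rho>\<^sup>2 / (real N)\<^sup>2) \<le> E / 2 / V" by simp
    also have "\<dots> = dirichlet_form (generator 1 N) (canonical N k) f
        / measure_pmf.variance (canonical N k) f"
      using M by (simp add: dirichlet_form_eq[OF k'(1) N] variance_eq[OF k'(1)] E_def V_def M_def)
    finally show "1 / 5520 * (\<rho>\<^sup>2 / (real N)\<^sup>2)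
        \<le> dirichlet_form (generator 1 N) (canonical N k) f / measure_pmf.variance (canonical N k) f" .
  qed
qed simp

end
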